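(* Let $n,k\to\infty$ while $\rho_l<\log n/\log k<\rho_u$ for some constants $1<\rho_l<\rho_u<\infty$. Then for any $\gamma>4$, asymptotically almost surely the mixing rate $\lambda$ of the pure drift Markov chain on a random graph from $B_n(k)$ satisfies $$\lambda>\frac{k}{n\log^\gamma k}.$$
   Context: Random graph $B_n(k)$ ($n,k\in\mathbb{Z}^+$): start from a cycle graph on $n$ nodes, choose uniformly at random a $k$-element subset of its $n$ edges, and remove the chosen edges. The cycle breaks into $k$ arcs (an arc may consist of a single node). For the $i$th arc, $1\le i\le k$, mark its clockwise endpoint as $a_i$ and its other end as $b_i$ ($a_i=b_i$ if the arc has one node). Then add all edges $(b_i,a_j)$, $1\le i,j\le k$ (including $i=j$). Pure drift Markov chain: within each arc, from every node other than $b_i$ the chain moves with probability $1$ to the next node of the arc in the direction from $a_i$ to $b_i$; from $b_i$ it moves to each $a_j$, $1\le j\le k$, with probability $1/k$. Mixing rate: for a Markov chain with transition matrix $P$, $\lambda=\min\{1-|\mu| : \mu\ne 1 \text{ is an eigenvalue of } P\}$ (complex eigenvalues). Notation: $\log$ is the natural logarithm and $\log^\gamma k=(\log k)^\gamma$. "Asymptotically almost surely" means with probability tending to $1$ in the stated limit. *)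

theory Defs
  imports "HOL-Probability.Probability" "Jordan_Normal_Form.Char_Poly"
begin

text \<open>
  The nodes of the cycle are \<open>0, \<dots>, n - 1\<close>, numbered counterclockwise, so that walking along an arc
  from its clockwise endpoint means adding 1 modulo \<open>n\<close>. Edge number \<open>i < n\<close> joins \<open>i\<close> and
  \<open>(i + 1) mod n\<close>, and the removed edges are given by the set \<open>S\<close> of their numbers.
  Within its arc a node \<open>v\<close> has a successor iff edge \<open>v\<close> is kept, and a predecessor iff the edge
  entering \<open>v\<close> is kept. Hence the ends \<open>b\<^sub>1, \<dots>, b\<^sub>k\<close> of the arcs are the elements of \<open>S\<close>, and the
  starts \<open>a\<^sub>1, \<dots>, a\<^sub>k\<close> are their successors on the cycle.
\<close>

definition cycle_succ :: "nat \<Rightarrow> nat \<Rightarrow> nat" where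
  "cycle_succ n v = Suc v mod n"

definition arc_starts :: "nat \<Rightarrow> nat set \<Rightarrow> nat set" where
  "arc_starts n S = {v \<in> {..<n}. \<exists>e\<in>S. v = cycle_succ n e}"

definition arc_ends :: "nat \<Rightarrow> nat set \<Rightarrow> nat set" where
  "arc_ends n S = {v \<in> {..<n}. v \<in> S}"

definition B_edges :: "nat \<Rightarrow> nat set \<Rightarrow> nat set set" where
  "B_edges n S = {{v, cycle_succ n v} | v. v \<in> {..<n} - S} \<union>
                 {{b, a} | b a. b \<in> arc_ends n S \<and> a \<in> arc_starts n S}"

text \<open>Sampling the removed edges; for \<open>k > n\<close> there is no such subset and the value is unspecified.\<close>

definition removed_edges :: "nat \<Rightarrow> nat \<Rightarrow> nat set pmf" where
  "removed_edges n k = pmf_of_set {S. S \<subseteq> {..<n} \<and> card S = k}"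

definition pure_drift :: "nat \<Rightarrow> nat set \<Rightarrow> nat \<Rightarrow> nat pmf" where
  "pure_drift n S v =
     (if v \<in> arc_ends n S then pmf_of_set (arc_starts n S) else return_pmf (cycle_succ n v))"

definition transition_matrix :: "nat \<Rightarrow> (nat \<Rightarrow> nat pmf) \<Rightarrow> complex mat" where
  "transition_matrix n K = mat n n (\<lambda>(v, w). complex_of_real (pmf (K v) w))"

definition mixing_rate :: "complex mat \<Rightarrow> real" where
  "mixing_rate P = Min {1 - cmod \<mu> | \<mu>. eigenvalue P \<mu> \<and> \<mu> \<noteq> 1}"

lemma arc_starts_eq:
  assumes "S \<subseteq> {..<n}"
  shows "arc_starts n S = cycle_succ n ` S"
  using assms by (force simp: arc_starts_def cycle_succ_def)

lemma arc_ends_eq: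
  assumes "S \<subseteq> {..<n}"
  shows "arc_ends n S = S"
  using assms by (auto simp: arc_ends_def)

lemma inj_on_cycle_succ: "inj_on (cycle_succ n) {..<n}"
  by (auto simp: inj_on_def cycle_succ_def mod_Suc split: if_splits)

lemma card_arc_starts:
  assumes "S \<subseteq> {..<n}"
  shows "card (arc_starts n S) = card S"
  using assms inj_on_subset[OF inj_on_cycle_succ]
  by (simp add: arc_starts_eq card_image)

lemma pmf_pure_drift_end:
  assumes "S \<subseteq> {..<n}" "b \<in> S"
  shows "pmf (pure_drift n S b) w = indicator (arc_starts n S) w / card S"
proof -
  have "finite (arc_starts n S)" "arc_starts n S \<noteq> {}"
    using assms by (auto simp: arc_starts_eq finite_subset)
  then show ?thesis
    using assms by (simp add: pure_drift_def arc_ends_eq card_arc_starts)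
qed

lemma pure_drift_along_edges:
  assumes "S \<subseteq> {..<n}" "v < n" "w \<in> set_pmf (pure_drift n S v)"
  shows "{v, w} \<in> B_edges n S"
proof (cases "v \<in> S")
  case True
  then have "finite (arc_starts n S)" "arc_starts n S \<noteq> {}"
    using assms by (auto simp: arc_starts_eq finite_subset)
  then show ?thesis
    using assms True by (auto simp: pure_drift_def arc_ends_eq B_edges_def)
next
  case False
  then show ?thesis
    using assms by (auto simp: pure_drift_def arc_ends_eq B_edges_def)
qed

lemma set_pmf_removed_edges:
  assumes "k \<le> n"
  shows "set_pmf (removed_edges n k) = {S. S \<subseteq> {..<n} \<and> card S = k}"
proof -
  have "finite {S. S \<subseteq> {..<n} \<and> card S = k}"
    by (rule finite_subset[of _ "Pow {..<n}"]) auto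
  moreover have "{..<k} \<in> {S. S \<subseteq> {..<n} \<and> card S = k}"
    using assms by auto
  ultimately show ?thesis
    unfolding removed_edges_def by (metis empty_iff set_pmf_of_set)
qed

end

theory Submission
  imports Defs "HOL-Number_Theory.Cong" "HOL-Real_Asymp.Real_Asymp"
begin

text \<open>
  Let \<open>g\<^sub>1, \<dots>, g\<^sub>k\<close> be the arc lengths. An eigenvector for \<open>\<mu> \<noteq> 0\<close> is multiplied by \<open>\<mu>\<close> along each
  step of an arc, so it is determined by its mean \<open>A\<close> over the arc starts: it has the value
  \<open>A / \<mu> ^ g\<^sub>i\<close> at the \<open>i\<close>th start. Hence \<open>z = 1 / \<mu>\<close> solves \<open>\<Sum>\<^sub>i z ^ g\<^sub>i = k\<close>
  (\<open>sum_gap_powers_eq_card\<close>), and the claim is that this equation has no solution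
  \<open>z = r cis \<theta>\<close> other than \<open>1\<close> with \<open>r\<close> too close to \<open>1\<close>.

  Put \<open>\<delta> = k / (n ln\<^sup>\<gamma> k)\<close> and let \<open>L\<close>, of order \<open>(n / k) ln k\<close>, bound all arc lengths. If
  \<open>1 - \<bar>\<mu>\<bar> \<le> \<delta>\<close>, then \<open>r ^ g\<^sub>i = 1 + O(\<delta> g\<^sub>i)\<close>, and as the \<open>g\<^sub>i\<close> add up to at most \<open>n\<close>, the real part
  of the equation gives \<open>\<Sum>\<^sub>i (1 - cos (\<theta> g\<^sub>i)) \<le> 4 \<delta> n = 4 k / ln\<^sup>\<gamma> k\<close>. For \<open>0 < \<bar>\<theta>\<bar> < 1 / L\<close> all the
  angles \<open>\<theta> g\<^sub>i\<close> lie strictly on one side of \<open>0\<close> and less than \<open>\<pi>\<close> away from it, so the imaginary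
  part of the sum cannot vanish; for \<open>\<theta> = 0\<close> the equation forces \<open>r = 1\<close>. What remains is to show
  that \<open>\<Sum>\<^sub>i (1 - cos (\<theta> g\<^sub>i))\<close> is large for all \<open>\<theta>\<close> in \<open>[1 / L, \<pi>]\<close> simultaneously
  (\<open>root_of_gap_equation_eq_1\<close>).

  For this the arc lengths are compared with independent geometric variables of parameter
  \<open>p = k / n\<close>. Conditioning independent variables on their total being \<open>n\<close> costs only a factor
  polynomial in \<open>n\<close>, so for \<open>0 \<le> f \<le> 1\<close> the expectation of \<open>\<Prod>\<^sub>i f (g\<^sub>i)\<close> is at most
  \<open>n (n + 1) \<psi> ^ (k - 1)\<close>, where \<open>\<psi>\<close> is the expectation of \<open>f\<close>
  under the geometric distribution (\<open>sum_prod_arc_gap_le\<close>). For \<open>f l = exp (- (1 - cos (\<theta> l)))\<close> the geometric series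
  is explicit, and gives \<open>\<psi> \<le> 1 - \<kappa>\<close> with \<open>\<kappa>\<close> of order \<open>1 / ln\<^sup>2 k\<close> once \<open>\<theta> \<ge> 1 / (2 L)\<close>
  (\<open>geometric_expectation_exp_le\<close>). So for one fixed \<open>\<theta>\<close> the sum is below \<open>\<kappa> k / 4\<close> only with probability
  \<open>exp (- c k / ln\<^sup>2 k)\<close> up to polynomial factors, which survives a union bound over the grid
  of all \<open>j / n\<close>: the sum moves by at most \<open>1\<close> between grid points, and \<open>n\<close> is polynomial in \<open>k\<close>.
  Since \<open>k / ln\<^sup>\<gamma> k\<close> is of smaller order than \<open>k / ln\<^sup>2 k\<close>, this is the required bound.
\<close>


section \<open>Arc lengths\<close>

text \<open>
  The distance from the removed edge \<open>e\<close> to the next removed edge on the cycle. As \<open>e\<close> is the end of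
  an arc, this is the number of nodes of the arc that follows.
\<close>

definition arc_gap :: "nat \<Rightarrow> nat set \<Rightarrow> nat \<Rightarrow> nat" where
  "arc_gap n S e = (LEAST l. 0 < l \<and> (e + l) mod n \<in> S)"

lemma arc_gap_le_if_mem: "0 < l \<Longrightarrow> (e + l) mod n \<in> S \<Longrightarrow> arc_gap n S e \<le> l"
  unfolding arc_gap_def by (rule Least_le) auto

lemma
  assumes "S \<subseteq> {..<n}" "e \<in> S"
  shows arc_gap_pos: "0 < arc_gap n S e"
    and arc_gap_mem: "(e + arc_gap n S e) mod n \<in> S"
proof -
  have "e < n" using assms by auto
  then have n: "0 < n \<and> (e + n) mod n \<in> S"
    using assms by auto
  from LeastI[where P = "\<lambda>l. 0 < l \<and> (e + l) mod n \<in> S", OF n]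
  show "0 < arc_gap n S e" "(e + arc_gap n S e) mod n \<in> S"
    by (auto simp: arc_gap_def)
qed

text \<open>
  Every node lies in only one arc: a coincidence of two positions, followed back along the shorter
  offset, would put an element of \<open>S\<close> strictly inside a gap.
\<close>

lemma inj_on_arc_positions:
  assumes S: "S \<subseteq> {..<n}"
  shows "inj_on (\<lambda>(e, i). (e + i) mod n) (SIGMA e:S. {1..arc_gap n S e})"
proof -
  have *: "e = e' \<and> i = i'"
    if e: "e \<in> S" "e' \<in> S" and i: "1 \<le> i" "i \<le> i'" "i' \<le> arc_gap n S e'"
      and eq: "(e + i) mod n = (e' + i') mod n" for e e' i i'
  proof -
    have lt: "e < n" "e' < n" using S e by auto
    have "(e' + (i' - i)) mod n = e"
    proof -
      have "[(e' + (i' - i)) + i = e + i] (mod n)"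
        using eq i by (simp add: cong_def)
      then have "[e' + (i' - i) = e] (mod n)"
        by (simp add: cong_add_rcancel_nat)
      then show ?thesis using lt by (simp add: cong_def)
    qed
    moreover have "i' - i < arc_gap n S e'" using i by auto
    ultimately have "\<not> 0 < i' - i"
      using arc_gap_le_if_mem[of "i' - i" e' n S] e by auto
    then have "i = i'" using i by auto
    with \<open>(e' + (i' - i)) mod n = e\<close> lt show ?thesis by simp
  qed
  show ?thesis
  proof (rule inj_onI, clarsimp, goal_cases)
    case (1 e i e' i')
    then show ?case
      using *[of e e' i i'] *[of e' e i' i] by (cases "i \<le> i'") auto
  qed
qed

lemma sum_arc_gap_le:
  assumes S: "S \<subseteq> {..<n}"
  shows "(\<Sum>e\<in>S. arc_gap n S e) \<le> n"
proof -
  have fin: "finite S" using S finite_subset by blast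
  have "card (SIGMA e:S. {1..arc_gap n S e}) \<le> card {..<n}"
    using S by (intro card_inj_on_le[OF inj_on_arc_positions[OF S]]) auto
  then show ?thesis using fin by simp
qed

section \<open>Eigenvalues in terms of the arc lengths\<close>

lemma transition_matrix_pure_drift_mult_vec:
  assumes S: "S \<subseteq> {..<n}" and x: "x \<in> carrier_vec n" and v: "v < n"
  shows "(transition_matrix n (pure_drift n S) *\<^sub>v x) $ v =
    (if v \<in> S then (\<Sum>e\<in>S. x $ cycle_succ n e) / card S else x $ cycle_succ n v)"
proof -
  have "(transition_matrix n (pure_drift n S) *\<^sub>v x) $ v
      = (\<Sum>w\<in>{0..<n}. complex_of_real (pmf (pure_drift n S v) w) * x $ w)"
    using x v by (auto simp: transition_matrix_def scalar_prod_def)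
  also have "\<dots> = (if v \<in> S then (\<Sum>e\<in>S. x $ cycle_succ n e) / card S else x $ cycle_succ n v)"
  proof (cases "v \<in> S")
    case True
    have starts: "arc_starts n S \<subseteq> {0..<n}" by (auto simp: arc_starts_def)
    have "(\<Sum>w\<in>{0..<n}. complex_of_real (pmf (pure_drift n S v) w) * x $ w)
        = (\<Sum>w\<in>arc_starts n S. x $ w / card S)"
      using starts
      by (intro sum.mono_neutral_cong_right) (auto simp: pmf_pure_drift_end[OF S True])
    also have "\<dots> = (\<Sum>e\<in>S. x $ cycle_succ n e / card S)"
      unfolding arc_starts_eq[OF S]
      using inj_on_subset[OF inj_on_cycle_succ S] by (simp add: sum.reindex)
    finally show ?thesis using True by (simp add: sum_divide_distrib)
  next
    case False
    then have "pure_drift n S v = return_pmf (cycle_succ n v)"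
      by (simp add: pure_drift_def arc_ends_eq[OF S])
    moreover have "cycle_succ n v \<in> {0..<n}" using v by (simp add: cycle_succ_def)
    ultimately have "(\<Sum>w\<in>{0..<n}. complex_of_real (pmf (pure_drift n S v) w) * x $ w)
        = (\<Sum>w\<in>{cycle_succ n v}. x $ w)"
      by (intro sum.mono_neutral_cong_right) (auto simp: indicator_def)
    then show ?thesis using False by simp
  qed
  finally show ?thesis .
qed

text \<open>
  Let \<open>A\<close> be the mean of an eigenvector over the arc starts, which is \<open>\<mu>\<close> times its value at every arc
  end. Walking along an arc of length \<open>g\<close> shows that the value at its start is \<open>A / \<mu> ^ g\<close>, and the
  mean of these values is again \<open>A\<close>. If \<open>A\<close> were \<open>0\<close>, walking back from the ends would make the
  eigenvector vanish everywhere.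
\<close>

lemma sum_gap_powers_eq_card:
  assumes S: "S \<subseteq> {..<n}" "S \<noteq> {}"
    and ev: "eigenvalue (transition_matrix n (pure_drift n S)) \<mu>" and \<mu>: "\<mu> \<noteq> 0"
  shows "(\<Sum>e\<in>S. (1 / \<mu>) ^ arc_gap n S e) = of_nat (card S)"
proof -
  let ?P = "transition_matrix n (pure_drift n S)"
  have P: "?P \<in> carrier_mat n n" by (simp add: transition_matrix_def)
  have fin: "finite S" using S finite_subset by blast
  from ev P obtain x where x: "x \<in> carrier_vec n" "x \<noteq> 0\<^sub>v n" "?P *\<^sub>v x = \<mu> \<cdot>\<^sub>v x"
    unfolding eigenvalue_def eigenvector_def by auto
  define A where "A = (\<Sum>e\<in>S. x $ cycle_succ n e) / of_nat (card S)"
  have row: "\<mu> * x $ v = (if v \<in> S then A else x $ cycle_succ n v)" if "v < n" for v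
    using transition_matrix_pure_drift_mult_vec[OF S(1) x(1) that] x that by (simp add: A_def)
  have "n > 0" using S by (cases n) auto

  have "x $ v = 0" if "A = 0" "v < n" "(v + d) mod n \<in> S" for v d
    using that(2,3)
  proof (induction d arbitrary: v)
    case 0
    then show ?case using row[of v] \<mu> \<open>A = 0\<close> by simp
  next
    case (Suc d)
    show ?case
    proof (cases "v \<in> S")
      case True
      then show ?thesis using row[of v] \<mu> \<open>A = 0\<close> Suc.prems by simp
    next
      case False
      have "(cycle_succ n v + d) mod n = (v + Suc d) mod n"
        by (simp add: cycle_succ_def mod_add_left_eq)
      then have "x $ cycle_succ n v = 0"
        using Suc \<open>n > 0\<close> by (intro Suc.IH) (auto simp: cycle_succ_def)
      then show ?thesis using row[of v] False \<mu> Suc.prems by simp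
    qed
  qed
  moreover have "\<exists>d. (v + d) mod n \<in> S" if "v < n" for v
  proof -
    obtain e where e: "e \<in> S" using S by auto
    then have "(v + (e + (n - v))) mod n = e" using S that by auto
    then show ?thesis using e by metis
  qed
  ultimately have A: "A \<noteq> 0"
    using x by (metis carrier_vecD eq_vecI index_zero_vec)

  have gap: "(1 / \<mu>) ^ arc_gap n S e = x $ cycle_succ n e / A" if e: "e \<in> S" for e
  proof -
    have walk: "x $ ((e + 1 + j) mod n) = \<mu> ^ j * x $ cycle_succ n e" if "j < arc_gap n S e" for j
      using that
    proof (induction j)
      case 0
      then show ?case by (simp add: cycle_succ_def)
    next
      case (Suc j)
      have "(e + 1 + j) mod n \<notin> S"
        using arc_gap_le_if_mem[of "1 + j" e n S] Suc.prems by (auto simp: add_ac)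
      moreover have "cycle_succ n ((e + 1 + j) mod n) = (e + 1 + Suc j) mod n"
        by (simp add: cycle_succ_def mod_Suc_eq)
      ultimately show ?case
        using row[of "(e + 1 + j) mod n"] Suc \<open>n > 0\<close> by (simp add: mult_ac)
    qed
    define g where "g = arc_gap n S e"
    have g: "0 < g" "(e + g) mod n \<in> S"
      using arc_gap_pos[OF S(1) e] arc_gap_mem[OF S(1) e] by (auto simp: g_def)
    have "x $ ((e + g) mod n) = \<mu> ^ (g - 1) * x $ cycle_succ n e"
      using walk[of "g - 1"] g by (simp add: g_def[symmetric])
    then have "A = \<mu> * (\<mu> ^ (g - 1) * x $ cycle_succ n e)"
      using row[of "(e + g) mod n"] g \<open>n > 0\<close> by simp
    also have "\<dots> = \<mu> ^ g * x $ cycle_succ n e" using g by (cases g) auto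
    finally show ?thesis using A \<mu> by (simp add: g_def[symmetric] field_simps)
  qed
  have "(\<Sum>e\<in>S. (1 / \<mu>) ^ arc_gap n S e) = (\<Sum>e\<in>S. x $ cycle_succ n e) / A"
    by (simp add: gap sum_divide_distrib)
  also have "(\<Sum>e\<in>S. x $ cycle_succ n e) = A * of_nat (card S)"
    using S fin by (simp add: A_def)
  finally show ?thesis using A by simp
qed

text \<open>
  All arc ends have the same row, so the difference of the unit vectors at two arc starts is in the
  kernel. This provides an eigenvalue other than \<open>1\<close>, so that \<^const>\<open>mixing_rate\<close> is the minimum of a
  nonempty set.
\<close>

lemma eigenvalue_0_pure_drift:
  assumes S: "S \<subseteq> {..<n}" and card: "2 \<le> card S"
  shows "eigenvalue (transition_matrix n (pure_drift n S)) 0"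
proof -
  let ?P = "transition_matrix n (pure_drift n S)"
  have P: "?P \<in> carrier_mat n n" by (simp add: transition_matrix_def)
  have fin: "finite S" using S finite_subset by blast
  obtain a b where ab: "a \<in> S" "b \<in> S" "a \<noteq> b"
    using card by (metis card_2_iff' card_le_Suc0_iff_eq fin not_less_eq_eq numeral_2_eq_2)
  have inj: "cycle_succ n v = cycle_succ n w \<longleftrightarrow> v = w" if "v < n" "w < n" for v w
    using inj_on_cycle_succ that by (auto simp: inj_on_def)
  have abn: "a < n" "b < n" using ab S by auto
  define x :: "complex vec" where
    "x = vec n (\<lambda>v. of_bool (v = cycle_succ n a) - of_bool (v = cycle_succ n b))"
  have succ: "cycle_succ n v < n" if "v < n" for v using that by (simp add: cycle_succ_def)
  have xs: "x $ cycle_succ n v = of_bool (v = a) - of_bool (v = b)" if "v < n" for v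
    using that abn succ[OF that] by (simp add: x_def inj)
  have x: "x \<in> carrier_vec n" by (simp add: x_def)
  have "(\<Sum>e\<in>S. x $ cycle_succ n e) = (\<Sum>e\<in>S. of_bool (e = a) - of_bool (e = b))"
    using S xs by (intro sum.cong) auto
  also have "\<dots> = 0"
    using fin ab by (simp add: sum_subtractf of_bool_def)
  finally have sum0: "(\<Sum>e\<in>S. x $ cycle_succ n e) = 0" .
  have "?P *\<^sub>v x = 0 \<cdot>\<^sub>v x"
  proof (rule eq_vecI)
    fix v assume "v < dim_vec (0 \<cdot>\<^sub>v x)"
    then have v: "v < n" using x by simp
    show "(?P *\<^sub>v x) $ v = (0 \<cdot>\<^sub>v x) $ v"
      using v x ab sum0 xs[OF v]
      by (auto simp: transition_matrix_pure_drift_mult_vec[OF S x v])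
  qed (use P x in auto)
  moreover have "x \<noteq> 0\<^sub>v n"
    using xs[OF abn(1)] ab succ[OF abn(1)] by auto
  ultimately show ?thesis
    using P x unfolding eigenvalue_def eigenvector_def by auto
qed

lemma less_mixing_rate:
  assumes P: "P \<in> carrier_mat n n"
    and ex: "eigenvalue P \<nu>" "\<nu> \<noteq> 1"
    and all: "\<And>\<mu>. eigenvalue P \<mu> \<Longrightarrow> \<mu> \<noteq> 1 \<Longrightarrow> c < 1 - cmod \<mu>"
  shows "c < mixing_rate P"
proof -
  have "char_poly P \<noteq> 0" using degree_monic_char_poly[OF P] by auto
  then have "finite {\<mu>. eigenvalue P \<mu>}"
    unfolding eigenvalue_root_char_poly[OF P] by (rule poly_roots_finite)
  then have "finite ((\<lambda>\<mu>. 1 - cmod \<mu>) ` {\<mu>. eigenvalue P \<mu> \<and> \<mu> \<noteq> 1})"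
    by (intro finite_imageI) (rule finite_subset[rotated], auto)
  then have "finite {1 - cmod \<mu> | \<mu>. eigenvalue P \<mu> \<and> \<mu> \<noteq> 1}"
    by (simp add: image_Collect)
  then show ?thesis
    unfolding mixing_rate_def using ex all by (subst Min_gr_iff) auto
qed

text \<open>
  Small angles are excluded by the imaginary part of the equation, all other angles by its
  real part; \<open>spread\<close> is exactly what the real part contradicts. Angles in \<open>[-\<pi>, 0]\<close>
  reduce to their absolute values, because the cosine is even and the sine is odd.
\<close>

lemma root_of_gap_equation_eq_1:
  fixes S :: "'a set" and g :: "'a \<Rightarrow> nat" and L \<delta> :: real and n :: nat
  assumes S: "finite S" "S \<noteq> {}" and g: "\<And>e. e \<in> S \<Longrightarrow> 0 < g e" "\<And>e. e \<in> S \<Longrightarrow> g e \<le> L"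
    and sum_g: "(\<Sum>e\<in>S. g e) \<le> n"
    and \<mu>: "\<mu> \<noteq> 0" and eq: "(\<Sum>e\<in>S. (1 / \<mu>) ^ g e) = of_nat (card S)"
    and \<delta>: "1 - cmod \<mu> \<le> \<delta>" "0 \<le> \<delta>" "\<delta> \<le> 1/2" "2 * \<delta> * L \<le> 1"
    and spread: "\<And>\<theta> :: real. 1 / L \<le> \<theta> \<Longrightarrow> \<theta> \<le> pi \<Longrightarrow> 4 * \<delta> * n < (\<Sum>e\<in>S. 1 - cos (\<theta> * g e))"
  shows "\<mu> = 1"
proof -
  define r where "r = 1 / cmod \<mu>"
  define \<phi> where "\<phi> = Arg (1 / \<mu>)"
  have r: "0 < r" using \<mu> by (simp add: r_def)
  have z: "1 / \<mu> = of_real r * cis \<phi>"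
    using rcis_cmod_Arg[of "1 / \<mu>"] by (simp add: rcis_def r_def \<phi>_def norm_divide)
  have pow: "(1 / \<mu>) ^ m = of_real (r ^ m) * cis (\<phi> * m)" for m
    unfolding z power_mult_distrib Complex.DeMoivre by (simp add: mult.commute)
  have Re: "(\<Sum>e\<in>S. r ^ g e * cos (\<phi> * g e)) = card S"
    using arg_cong[OF eq, of Re] by (simp add: pow Re_sum del: of_real_power)
  have Im: "(\<Sum>e\<in>S. r ^ g e * sin (\<phi> * g e)) = 0"
    using arg_cong[OF eq, of Im] by (simp add: pow Im_sum del: of_real_power)

  \<comment> \<open>a root with \<open>r < 1\<close> would make the sum smaller than the number of its terms\<close>
  have "1 \<le> r"
  proof (rule ccontr)
    assume "\<not> 1 \<le> r"
    then have "r < 1" by simp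
    have "(\<Sum>e\<in>S. r ^ g e * cos (\<phi> * g e)) < (\<Sum>e\<in>S. 1)"
    proof (rule sum_strict_mono)
      fix e assume "e \<in> S"
      have "r ^ g e * cos (\<phi> * g e) \<le> r ^ g e * 1" using r by (intro mult_left_mono) auto
      also have "r ^ g e < 1" using \<open>r < 1\<close> r g(1)[OF \<open>e \<in> S\<close>] by (simp add: power_less_one_iff)
      finally show "r ^ g e * cos (\<phi> * g e) < 1" by simp
    qed (use S in auto)
    then show False using Re by simp
  qed

  have "r \<le> 1 + 2 * \<delta>"
  proof -
    have "1 \<le> (1 + 2 * \<delta>) * (1 - \<delta>)"
    proof -
      have "0 \<le> \<delta> * (1 - 2 * \<delta>)" using \<delta> by simp
      then show ?thesis by (simp add: algebra_simps)
    qed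
    also have "\<dots> \<le> (1 + 2 * \<delta>) * cmod \<mu>" using \<delta> by (intro mult_left_mono) auto
    finally show ?thesis using \<mu> by (simp add: r_def field_simps)
  qed
  \<comment> \<open>the quadratic bound for the exponential applies since \<open>2 \<delta> g \<le> 2 \<delta> L \<le> 1\<close>\<close>
  have r_pow: "r ^ g e \<le> 1 + 4 * \<delta> * g e" if e: "e \<in> S" for e
  proof -
    have "r \<le> exp (2 * \<delta>)" using \<open>r \<le> 1 + 2 * \<delta>\<close> exp_ge_add_one_self[of "2 * \<delta>"] by linarith
    then have "r ^ g e \<le> exp (2 * \<delta>) ^ g e" using r by (intro power_mono) auto
    also have "\<dots> = exp (2 * \<delta> * g e)" by (simp add: exp_of_nat_mult[symmetric] mult.commute)
    also have "\<dots> \<le> 1 + 2 * \<delta> * g e + (2 * \<delta> * g e)\<^sup>2"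
    proof (rule exp_bound)
      have "2 * \<delta> * g e \<le> 2 * \<delta> * L" using g(2)[OF e] \<delta> by (intro mult_left_mono) auto
      then show "2 * \<delta> * g e \<le> 1" using \<delta> by simp
    qed (use \<delta> in auto)
    also have "\<dots> \<le> 1 + 2 * \<delta> * g e + 2 * \<delta> * g e"
    proof -
      have "2 * \<delta> * g e \<le> 2 * \<delta> * L" using g(2)[OF e] \<delta> by (intro mult_left_mono) auto
      then have "(2 * \<delta> * g e) * (2 * \<delta> * g e) \<le> (2 * \<delta> * g e) * 1"
        using \<delta> by (intro mult_left_mono) auto
      then show ?thesis by (simp add: power2_eq_square)
    qed
    finally show ?thesis by simp
  qed
  obtain e0 where e0: "e0 \<in> S" using S by auto
  have L: "0 < L" using g[OF e0] by linarith

  \<comment> \<open>the real part: here \<open>r ^ g \<ge> 1\<close> on the left, and the equation turns the right into the sum of \<open>r ^ g - 1\<close>\<close>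
  have upper: "(\<Sum>e\<in>S. 1 - cos (\<bar>\<phi>\<bar> * g e)) \<le> 4 * \<delta> * n"
  proof -
    have cos_abs: "cos (\<bar>\<phi>\<bar> * m) = cos (\<phi> * m)" for m :: real by (cases "0 \<le> \<phi>") auto
    have "(\<Sum>e\<in>S. 1 - cos (\<bar>\<phi>\<bar> * g e)) \<le> (\<Sum>e\<in>S. r ^ g e * (1 - cos (\<phi> * g e)))"
    proof (rule sum_mono)
      fix e
      have "1 * (1 - cos (\<phi> * g e)) \<le> r ^ g e * (1 - cos (\<phi> * g e))"
        using \<open>1 \<le> r\<close> by (intro mult_right_mono one_le_power) auto
      then show "1 - cos (\<bar>\<phi>\<bar> * g e) \<le> r ^ g e * (1 - cos (\<phi> * g e))" by (simp add: cos_abs)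
    qed
    also have "\<dots> = (\<Sum>e\<in>S. r ^ g e - 1)"
      using Re by (simp add: right_diff_distrib sum_subtractf)
    also have "\<dots> \<le> (\<Sum>e\<in>S. 4 * \<delta> * g e)"
      using r_pow by (intro sum_mono) (simp add: algebra_simps)
    also have "\<dots> = 4 * \<delta> * real (\<Sum>e\<in>S. g e)" by (simp add: sum_distrib_left)
    also have "\<dots> \<le> 4 * \<delta> * n" using sum_g \<delta> by (intro mult_left_mono) (simp_all del: of_nat_sum)
    finally show ?thesis .
  qed
  have "\<bar>\<phi>\<bar> \<le> pi" using Arg_bounded[of "1 / \<mu>"] by (auto simp: \<phi>_def)
  then have small: "\<bar>\<phi>\<bar> < 1 / L" using spread[of "\<bar>\<phi>\<bar>"] upper by (meson not_less)

  have "\<phi> = 0"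
  proof (rule ccontr)
    assume "\<phi> \<noteq> 0"
    have "0 < (\<Sum>e\<in>S. r ^ g e * (sgn \<phi> * sin (\<phi> * g e)))"
    proof (rule sum_pos)
      fix e assume e: "e \<in> S"
      have "\<bar>\<phi>\<bar> * g e \<le> \<bar>\<phi>\<bar> * L" using g(2)[OF e] by (intro mult_left_mono) auto
      also have "\<dots> < 1" using small L by (simp add: field_simps)
      also have "1 < pi" using pi_gt3 by simp
      finally have "0 < sin (\<bar>\<phi>\<bar> * g e)"
        using \<open>\<phi> \<noteq> 0\<close> g(1)[OF e] by (intro sin_gt_zero) auto
      moreover have "sgn \<phi> * sin (\<phi> * g e) = sin (\<bar>\<phi>\<bar> * g e)"
        using \<open>\<phi> \<noteq> 0\<close> by (cases "0 < \<phi>") auto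
      ultimately show "0 < r ^ g e * (sgn \<phi> * sin (\<phi> * g e))" using r by simp
    qed (use S in auto)
    also have "\<dots> = sgn \<phi> * (\<Sum>e\<in>S. r ^ g e * sin (\<phi> * g e))"
      by (simp add: sum_distrib_left mult_ac)
    finally show False using Im by simp
  qed
  have "r = 1"
  proof (rule ccontr)
    assume "r \<noteq> 1"
    then have "1 < r" using \<open>1 \<le> r\<close> by simp
    then have "(\<Sum>e\<in>S. 1) < (\<Sum>e\<in>S. r ^ g e * cos (\<phi> * g e))"
      using S g(1) by (intro sum_strict_mono) (auto simp: \<open>\<phi> = 0\<close> one_less_power)
    then show False using Re by simp
  qed
  then show ?thesis using z \<mu> \<open>\<phi> = 0\<close> by (simp add: field_simps)
qed

lemma mixing_rate_gt_if_spread: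
  fixes L \<delta> :: real
  assumes S: "S \<subseteq> {..<n}" "2 \<le> card S"
    and gaps: "\<And>e. e \<in> S \<Longrightarrow> arc_gap n S e \<le> L"
    and \<delta>: "0 \<le> \<delta>" "\<delta> \<le> 1/2" "2 * \<delta> * L \<le> 1"
    and spread: "\<And>\<theta> :: real. 1 / L \<le> \<theta> \<Longrightarrow> \<theta> \<le> pi \<Longrightarrow>
                   4 * \<delta> * n < (\<Sum>e\<in>S. 1 - cos (\<theta> * arc_gap n S e))"
  shows "\<delta> < mixing_rate (transition_matrix n (pure_drift n S))"
proof (rule less_mixing_rate)
  show "transition_matrix n (pure_drift n S) \<in> carrier_mat n n"
    by (simp add: transition_matrix_def)
  show "eigenvalue (transition_matrix n (pure_drift n S)) 0"
    using S by (rule eigenvalue_0_pure_drift)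
  fix \<mu> assume ev: "eigenvalue (transition_matrix n (pure_drift n S)) \<mu>" and "\<mu> \<noteq> 1"
  show "\<delta> < 1 - cmod \<mu>"
  proof (rule ccontr)
    assume "\<not> \<delta> < 1 - cmod \<mu>"
    then have le: "1 - cmod \<mu> \<le> \<delta>" by simp
    then have "\<mu> \<noteq> 0" using \<delta> by auto
    have ne: "finite S" "S \<noteq> {}" using S finite_subset[of S "{..<n}"] by auto
    have "\<mu> = 1"
      by (rule root_of_gap_equation_eq_1[OF ne _ gaps sum_arc_gap_le[OF S(1)] \<open>\<mu> \<noteq> 0\<close>
            sum_gap_powers_eq_card[OF S(1) ne(2) ev \<open>\<mu> \<noteq> 0\<close>] le \<delta> spread])
         (use arc_gap_pos[OF S(1)] in auto)
    then show False using \<open>\<mu> \<noteq> 1\<close> by simp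
  qed
qed simp

section \<open>No arc is much longer than average\<close>

lemma card_subsets_avoiding:
  fixes n k :: nat
  assumes A: "A \<subseteq> {..<n}"
  shows "card {S. S \<subseteq> {..<n} \<and> card S = k \<and> S \<inter> A = {}} = (n - card A) choose k"
proof -
  have fin: "finite A" using A finite_subset by blast
  have "{S. S \<subseteq> {..<n} \<and> card S = k \<and> S \<inter> A = {}} = {S. S \<subseteq> {..<n} - A \<and> card S = k}"
    by auto
  also have "card \<dots> = card ({..<n} - A) choose k"
    by (rule n_subsets) auto
  also have "card ({..<n} - A) = n - card A"
    using A fin by (simp add: card_Diff_subset)
  finally show ?thesis .
qed

text \<open>
  Choosing \<open>k\<close> points without replacement, each one avoids \<open>m\<close> given points with conditional
  probability at most \<open>1 - m / n\<close>.
\<close>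

lemma binomial_ratio_le:
  assumes "k \<le> n" "m \<le> n" "0 < n"
  shows "real ((n - m) choose k) \<le> (1 - m / n) ^ k * real (n choose k)"
  using assms
proof (induction k)
  case (Suc k)
  show ?case
  proof (cases "Suc k \<le> n - m")
    case False
    then show ?thesis using Suc.prems by (simp add: binomial_eq_0)
  next
    case True
    have step: "real (N choose Suc k) = real (N choose k) * (real N - real k) / real (Suc k)"
      if "Suc k \<le> N" for N
    proof -
      have "Suc k * (N choose Suc k) = (N - k) * (N choose k)"
        by (metis binomial_absorb_comp binomial_absorption mult.commute Suc_times_binomial_eq)
      then have "real (Suc k) * real (N choose Suc k) = real (N - k) * real (N choose k)"
        by (metis of_nat_mult)
      then show ?thesis using that by (simp add: field_simps of_nat_diff)
    qed
    have IH: "real ((n - m) choose k) \<le> (1 - m / n) ^ k * real (n choose k)"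
      using Suc by auto
    have "real n * (real (n - m) - real k) \<le> (real n - real m) * (real n - real k)"
      using Suc.prems by (simp add: algebra_simps of_nat_diff)
    then have "real (n - m) - real k \<le> (1 - m / n) * (real n - real k)"
      using Suc.prems by (simp add: field_simps)
    then have "real ((n - m) choose k) * (real (n - m) - real k)
        \<le> ((1 - m / n) ^ k * real (n choose k)) * ((1 - m / n) * (real n - real k))"
      using IH True Suc.prems by (intro mult_mono) (auto simp: field_simps)
    from divide_right_mono[OF this, of "real (Suc k)"] show ?thesis
      using True Suc.prems by (simp add: step mult_ac)
  qed
qed auto

text \<open>
  An arc longer than \<open>m\<close> leaves one of the \<open>n\<close> cyclic intervals of length \<open>m\<close> without removed edges.
\<close>

lemma card_large_gap_le:
  assumes k: "k \<le> n" and n: "0 < n" and m: "m \<le> n"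
  shows "real (card {S. S \<subseteq> {..<n} \<and> card S = k \<and> (\<exists>e\<in>S. m < arc_gap n S e)})
          \<le> n * (1 - m / n) ^ k * real (n choose k)"
proof -
  define J where "J e = (\<lambda>i. (e + i) mod n) ` {1..m}" for e
  have J: "J e \<subseteq> {..<n}" for e using n by (auto simp: J_def)
  have card_J: "card (J e) = m" for e
  proof -
    have "inj_on (\<lambda>i. (e + i) mod n) {1..m}"
    proof (rule inj_onI)
      fix i j assume ij: "i \<in> {1..m}" "j \<in> {1..m}" "(e + i) mod n = (e + j) mod n"
      have "[i = j] (mod n)"
        using ij(3) unfolding cong_def[symmetric] by (simp only: cong_add_lcancel_nat)
      then have eq: "i mod n = j mod n" by (simp only: cong_def)
      have bounds: "i \<le> n" "j \<le> n" "0 < i" "0 < j" using ij(1,2) m by auto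
      have "l mod n = (if l = n then 0 else l)" if "l \<le> n" for l
        using that by auto
      from this[OF bounds(1)] this[OF bounds(2)] eq bounds show "i = j"
        by (simp only: split: if_splits)
    qed
    then show ?thesis by (simp add: J_def card_image)
  qed
  have "{S. S \<subseteq> {..<n} \<and> card S = k \<and> (\<exists>e\<in>S. m < arc_gap n S e)}
      \<subseteq> (\<Union>e<n. {S. S \<subseteq> {..<n} \<and> card S = k \<and> S \<inter> J e = {}})" (is "?L \<subseteq> ?R")
  proof
    fix S assume "S \<in> ?L"
    then obtain e where S: "S \<subseteq> {..<n}" "card S = k" and e: "e \<in> S" "m < arc_gap n S e"
      by auto
    have "(e + i) mod n \<notin> S" if "i \<in> {1..m}" for i
      using arc_gap_le_if_mem[of i e n S] that e(2) by fastforce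
    then have "S \<inter> J e = {}" unfolding J_def by blast
    moreover have "e < n" using S e by auto
    ultimately show "S \<in> ?R" using S by blast
  qed
  moreover have "finite ?R"
    by (rule finite_subset[of _ "Pow {..<n}"]) auto
  ultimately have "card ?L \<le> card ?R" by (rule card_mono[rotated])
  also have "\<dots> \<le> (\<Sum>e<n. card {S. S \<subseteq> {..<n} \<and> card S = k \<and> S \<inter> J e = {}})"
    by (rule card_UN_le) auto
  also have "\<dots> = n * ((n - m) choose k)"
    by (simp only: card_subsets_avoiding[OF J] card_J) simp
  finally have "real (card ?L) \<le> n * real ((n - m) choose k)"
    unfolding of_nat_mult[symmetric] of_nat_le_iff .
  also have "\<dots> \<le> n * ((1 - m / n) ^ k * real (n choose k))"
    using binomial_ratio_le[OF k m n] by (intro mult_left_mono) auto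
  finally show ?thesis by (simp add: mult.assoc)
qed

section \<open>Exponential moments of the arc lengths\<close>

text \<open>
  The product of \<open>f\<close> over the distances between neighbouring elements of \<open>S\<close>, leaving out the
  distance that wraps around the cycle. Without it, removing the minimum of \<open>S\<close> changes no other
  distance, which allows induction on the size of \<open>S\<close>.
\<close>

definition path_weight :: "(nat \<Rightarrow> real) \<Rightarrow> nat set \<Rightarrow> real" where
  "path_weight f S = (\<Prod>e\<in>S - {Max S}. f (Min {y \<in> S. e < y} - e))"

lemma path_weight_nonneg: "(\<And>l. 0 \<le> f l) \<Longrightarrow> 0 \<le> path_weight f S"
  unfolding path_weight_def by (intro prod_nonneg) auto

lemma path_weight_singleton: "path_weight f {s} = 1"
  by (simp add: path_weight_def)

lemma path_weight_insert:
  assumes T: "finite T" "T \<noteq> {}" and s: "s < Min T"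
  shows "path_weight f (insert s T) = f (Min T - s) * path_weight f T"
proof -
  have lt: "s < y" if "y \<in> T" for y using T s that by auto
  have Max: "Max (insert s T) = Max T"
    using T lt[of "Max T"] by (simp add: max_def)
  have *: "insert s T - {Max T} = insert s (T - {Max T})" "s \<notin> T"
    using T lt[of "Max T"] lt[of s] by auto
  have above_s: "{y \<in> insert s T. s < y} = T" using lt by auto
  have above: "{y \<in> insert s T. e < y} = {y \<in> T. e < y}" if "e \<in> T" for e
    using lt[OF that] by auto
  have "path_weight f (insert s T) =
      f (Min T - s) * (\<Prod>e\<in>T - {Max T}. f (Min {y \<in> insert s T. e < y} - e))"
    unfolding path_weight_def Max *(1)
    by (subst prod.insert) (use T(1) *(2) in \<open>simp_all only: above_s finite_Diff Diff_iff simp_thms\<close>)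
  also have "(\<Prod>e\<in>T - {Max T}. f (Min {y \<in> insert s T. e < y} - e)) = path_weight f T"
    unfolding path_weight_def by (rule prod.cong) (use above in auto)
  finally show ?thesis .
qed

lemma subsets_card_Suc_eq:
  fixes n k :: nat
  assumes k: "0 < k"
  shows "bij_betw (\<lambda>(T, s). insert s T)
     (SIGMA T:{T. T \<subseteq> {..<n} \<and> card T = k}. {..<Min T}) {S. S \<subseteq> {..<n} \<and> card S = Suc k}"
proof (rule bij_betwI[where g = "\<lambda>S. (S - {Min S}, Min S)"], goal_cases)
  case 1
  show ?case
  proof (clarsimp, intro conjI)
    fix T s assume T: "T \<subseteq> {..<n}" "s < Min T" "k = card T"
    then have fin: "finite T" "T \<noteq> {}" using k finite_subset by (blast, auto)
    then have "Min T \<in> T" by simp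
    then show "s < n" using T by auto
    show "card (insert s T) = Suc (card T)"
      using T fin by (metis Min_le card_insert_disjoint linorder_not_less)
  qed
next
  case 2
  show ?case
  proof (clarsimp, intro conjI)
    fix S assume S: "S \<subseteq> {..<n}" "card S = Suc k"
    then have fin: "finite S" "S \<noteq> {}" by (auto simp: card_Suc_eq intro: card_ge_0_finite)
    show "S - {Min S} \<subseteq> {..<n}" using S by auto
    show "card (S - {Min S}) = k" using S fin by simp
    then have "S - {Min S} \<noteq> {}" using k by (metis card.empty less_irrefl)
    then show "Min S < Min (S - {Min S})"
      using fin by (metis DiffE Diff_subset Min_antimono Min_in finite_Diff insertI1 order_le_less)
  qed
next
  case (3 x)
  then obtain T s where x: "x = (T, s)" "T \<subseteq> {..<n}" "s < Min T" "card T = k" by auto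
  then have fin: "finite T" "T \<noteq> {}" using k finite_subset by (blast, auto)
  then have "Min (insert s T) = s" using x by simp
  moreover have "s \<notin> T" using fin x by (meson Min_le linorder_not_less)
  ultimately show ?case using x by simp
next
  case (4 S)
  then have "finite S" "S \<noteq> {}" by (auto intro: card_ge_0_finite)
  then show ?case by (simp add: insert_absorb)
qed

text \<open>
  The weight \<open>q ^ (n - Min S)\<close> is chosen so that adding a new minimum at distance \<open>l\<close> multiplies
  the summand by \<open>f l * q ^ l\<close>, independently of the rest of \<open>S\<close>.
\<close>

lemma sum_path_weight_le:
  fixes f :: "nat \<Rightarrow> real" and q \<phi> :: real
  assumes f: "\<And>l. 0 \<le> f l" and q: "0 < q" "q \<le> 1"
    and \<phi>: "(\<Sum>l=1..n. f l * q ^ l) \<le> \<phi>"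
  shows "(\<Sum>S | S \<subseteq> {..<n} \<and> card S = Suc k. path_weight f S * q ^ (n - Min S)) \<le> n * \<phi> ^ k"
proof (induction k)
  case 0
  have "{S. S \<subseteq> {..<n} \<and> card S = Suc 0} = (\<lambda>s. {s}) ` {..<n}"
    by (auto simp: card_Suc_eq)
  moreover have "inj_on (\<lambda>s::nat. {s}) {..<n}" by (auto simp: inj_on_def)
  ultimately have "(\<Sum>S | S \<subseteq> {..<n} \<and> card S = Suc 0. path_weight f S * q ^ (n - Min S))
      = (\<Sum>s<n. q ^ (n - s))"
    by (simp add: sum.reindex path_weight_singleton)
  also have "\<dots> \<le> (\<Sum>s<n. 1)"
    using q by (intro sum_mono power_le_one) auto
  finally show ?case by simp
next
  case (Suc k)
  \<comment> \<open>a set of size \<open>k + 2\<close> is a set \<open>T\<close> of size \<open>k + 1\<close> together with a new minimum \<open>s\<close>\<close>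
  define \<F> where "\<F> = {T. T \<subseteq> {..<n} \<and> card T = Suc k}"
  have fin: "finite \<F>" unfolding \<F>_def by (rule finite_subset[of _ "Pow {..<n}"]) auto
  have "0 \<le> (\<Sum>l=1..n. f l * q ^ l)" using f q by (intro sum_nonneg) auto
  then have \<phi>0: "0 \<le> \<phi>" using \<phi> by linarith
  have "(\<Sum>S | S \<subseteq> {..<n} \<and> card S = Suc (Suc k). path_weight f S * q ^ (n - Min S))
      = (\<Sum>(T, s)\<in>(SIGMA T:\<F>. {..<Min T}). path_weight f (insert s T) * q ^ (n - Min (insert s T)))"
    unfolding \<F>_def
    by (subst sum.reindex_bij_betw[OF subsets_card_Suc_eq[of "Suc k" n], symmetric])
       (auto simp: case_prod_unfold)
  also have "\<dots> = (\<Sum>T\<in>\<F>. \<Sum>s<Min T. path_weight f (insert s T) * q ^ (n - Min (insert s T)))"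
    using fin by (subst sum.Sigma) auto
  also have "\<dots> \<le> (\<Sum>T\<in>\<F>. path_weight f T * q ^ (n - Min T) * \<phi>)"
  proof (rule sum_mono)
    fix T assume "T \<in> \<F>"
    then have T: "finite T" "T \<noteq> {}" "T \<subseteq> {..<n}"
      by (auto simp: \<F>_def intro: card_ge_0_finite)
    then have Min: "Min T < n" using Min_in by blast
    have "(\<Sum>s<Min T. path_weight f (insert s T) * q ^ (n - Min (insert s T)))
       = (\<Sum>s<Min T. path_weight f T * q ^ (n - Min T) * (f (Min T - s) * q ^ (Min T - s)))"
    proof (rule sum.cong[OF refl])
      fix s assume "s \<in> {..<Min T}"
      then have s: "s < Min T" by simp
      then have "Min (insert s T) = s" using T by simp
      moreover have "n - s = (n - Min T) + (Min T - s)" using s Min by simp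
      ultimately show "path_weight f (insert s T) * q ^ (n - Min (insert s T))
          = path_weight f T * q ^ (n - Min T) * (f (Min T - s) * q ^ (Min T - s))"
        using T s by (simp add: path_weight_insert power_add)
    qed
    also have "\<dots> = path_weight f T * q ^ (n - Min T) * (\<Sum>s<Min T. f (Min T - s) * q ^ (Min T - s))"
      by (simp add: sum_distrib_left)
    also have "(\<Sum>s<Min T. f (Min T - s) * q ^ (Min T - s)) = (\<Sum>l=1..Min T. f l * q ^ l)"
      by (rule sum.reindex_bij_witness[of _ "\<lambda>l. Min T - l" "\<lambda>s. Min T - s"]) auto
    also have "\<dots> \<le> (\<Sum>l=1..n. f l * q ^ l)"
      using Min f q by (intro sum_mono2) auto
    also have "\<dots> \<le> \<phi>" by (rule \<phi>)
    finally show "(\<Sum>s<Min T. path_weight f (insert s T) * q ^ (n - Min (insert s T)))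
        \<le> path_weight f T * q ^ (n - Min T) * \<phi>"
      using path_weight_nonneg[of f T] f q by (simp add: mult_left_mono)
  qed
  also have "\<dots> = (\<Sum>T\<in>\<F>. path_weight f T * q ^ (n - Min T)) * \<phi>"
    by (simp add: sum_distrib_right)
  also have "\<dots> \<le> n * \<phi> ^ k * \<phi>"
    using Suc.IH \<phi>0 by (intro mult_right_mono) (auto simp: \<F>_def)
  finally show ?case by (simp add: mult_ac)
qed

text \<open>
  With \<open>p = k / n\<close> the mode of the binomial distribution is \<open>k\<close>, so this value has at least the
  average of the \<open>n + 1\<close> probabilities.
\<close>

lemma binomial_mode_ge:
  fixes n k :: nat
  assumes k: "k < n"
  defines "p \<equiv> real k / real n"
  shows "1 \<le> (n + 1) * (real (n choose k) * p ^ k * (1 - p) ^ (n - k))"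
proof -
  define t where "t j = real (n choose j) * p ^ j * (1 - p) ^ (n - j)" for j
  have p: "0 \<le> p" "p < 1" using k by (auto simp: p_def)
  have nn: "0 \<le> t j" for j using p by (simp add: t_def)
  \<comment> \<open>hence the terms increase up to \<open>j = k\<close> and decrease afterwards\<close>
  have ratio: "t (Suc j) * (real (Suc j) * (n - k)) = t j * ((real n - real j) * k)" if "j < n" for j
  proof -
    have "Suc j * (n choose Suc j) = (n - j) * (n choose j)"
      by (metis binomial_absorb_comp binomial_absorption mult.commute Suc_times_binomial_eq)
    then have b: "real (Suc j) * real (n choose Suc j) = (real n - real j) * real (n choose j)"
      using that by (metis less_imp_le of_nat_diff of_nat_mult)
    have e: "n - j = Suc (n - Suc j)" using that by simp
    have q: "(1 - p) * n = real n - k" "p * n = k" using k by (auto simp: p_def field_simps)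
    have "t (Suc j) * (real (Suc j) * (real n - k))
        = (real (Suc j) * real (n choose Suc j)) * p ^ j * (1 - p) ^ (n - Suc j) * (p * (real n - k))"
      by (simp add: t_def mult_ac)
    also have "p * (real n - k) = (1 - p) * k"
      using q by (metis mult.assoc mult.commute)
    also have "(real (Suc j) * real (n choose Suc j)) * p ^ j * (1 - p) ^ (n - Suc j) * ((1 - p) * k)
        = t j * ((real n - real j) * k)"
      unfolding b by (simp add: t_def e mult_ac)
    finally show ?thesis using k by (simp add: of_nat_diff)
  qed
  have up: "t j \<le> t (Suc j)" if "j < k" for j
  proof -
    have "real (Suc j) * (n - k) \<le> (real n - real j) * k"
    proof -
      have "real (Suc j) * real n \<le> real k * real n" using that by (intro mult_right_mono) auto
      moreover have "real (n - k) = real n - real k" "real k \<le> real n" using k by auto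
      ultimately show ?thesis by (simp only: of_nat_Suc ring_distribs mult.commute mult_1_left)
    qed
    then have "t j * (real (Suc j) * (n - k)) \<le> t (Suc j) * (real (Suc j) * (n - k))"
      unfolding ratio[OF less_trans[OF that k]] using nn by (intro mult_left_mono) auto
    then show ?thesis using k by (simp add: mult_le_cancel_right)
  qed
  have down: "t (Suc j) \<le> t j" if "k \<le> j" "j < n" for j
  proof -
    have "(real n - real j) * k \<le> real (Suc j) * (n - k)"
    proof -
      have "real k * real n \<le> real j * real n" using that by (intro mult_right_mono) auto
      moreover have "real (n - k) = real n - real k" "real k \<le> real n" using k by auto
      ultimately show ?thesis by (simp only: of_nat_Suc ring_distribs mult.commute mult_1_left)
    qed
    then have "t (Suc j) * (real (Suc j) * (n - k)) \<le> t j * (real (Suc j) * (n - k))"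
      unfolding ratio[OF that(2)] using nn by (intro mult_left_mono) auto
    then show ?thesis using k by (simp add: mult_le_cancel_right)
  qed
  have max: "t j \<le> t k" if "j \<le> n" for j
  proof (cases "j \<le> k")
    case True
    then show ?thesis
      by (induction rule: inc_induct) (use up order_trans in blast)+
  next
    case False
    then have "k \<le> j" by simp
    then show ?thesis using that
    proof (induction rule: dec_induct)
      case (step m)
      then show ?case using down[of m] by fastforce
    qed auto
  qed
  have "1 = (p + (1 - p)) ^ n" by simp
  also have "\<dots> = (\<Sum>j\<le>n. t j)" unfolding binomial_ring t_def by simp
  also have "\<dots> \<le> (\<Sum>j\<le>n. t k)" using max by (intro sum_mono) auto
  finally show ?thesis by (simp add: t_def)
qed

lemma arc_gap_below_Max:
  assumes S: "S \<subseteq> {..<n}" and e: "e \<in> S" "e \<noteq> Max S"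
  shows "arc_gap n S e = Min {y \<in> S. e < y} - e"
proof -
  have fin: "finite S" using S finite_subset by blast
  have "e < Max S" using fin e by (simp add: order_less_le)
  moreover have "Max S \<in> S" using fin e by (intro Max_in) auto
  ultimately have "Max S \<in> {y \<in> S. e < y}" by auto
  then have ne: "finite {y \<in> S. e < y}" "{y \<in> S. e < y} \<noteq> {}" using fin by auto
  define b where "b = Min {y \<in> S. e < y}"
  have b: "b \<in> S" "e < b" using Min_in[OF ne] by (auto simp: b_def)
  then have bn: "b < n" using S by auto
  show ?thesis unfolding b_def[symmetric] arc_gap_def
  proof (rule Least_equality)
    show "0 < b - e \<and> (e + (b - e)) mod n \<in> S" using b bn by simp
  next
    fix l assume l: "0 < l \<and> (e + l) mod n \<in> S"
    show "b - e \<le> l"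
    proof (rule ccontr)
      assume "\<not> b - e \<le> l"
      then have "e + l < b" by simp
      then have "e + l \<in> {y \<in> S. e < y}" using l bn by simp
      then have "b \<le> e + l" unfolding b_def using ne by (intro Min_le)
      with \<open>e + l < b\<close> show False by simp
    qed
  qed
qed

text \<open>
  Since \<open>f\<close> is at most \<open>1\<close>, the factor of the arc that wraps around the cycle can be dropped.
\<close>

lemma prod_arc_gap_le_path_weight:
  assumes S: "S \<subseteq> {..<n}" "S \<noteq> {}" and f: "\<And>l. 0 \<le> f l" "\<And>l. f l \<le> 1"
  shows "(\<Prod>e\<in>S. f (arc_gap n S e)) \<le> path_weight f S"
proof -
  have fin: "finite S" using S finite_subset by blast
  then have "(\<Prod>e\<in>S. f (arc_gap n S e))
      = f (arc_gap n S (Max S)) * (\<Prod>e\<in>S - {Max S}. f (arc_gap n S e))"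
    using S by (intro prod.remove) auto
  also have "(\<Prod>e\<in>S - {Max S}. f (arc_gap n S e)) = path_weight f S"
    unfolding path_weight_def using S by (intro prod.cong) (auto simp: arc_gap_below_Max)
  also have "f (arc_gap n S (Max S)) * path_weight f S \<le> 1 * path_weight f S"
    using f path_weight_nonneg by (intro mult_right_mono) auto
  finally show ?thesis by simp
qed

text \<open>
  The comparison with independent geometric arc lengths; \<open>\<psi>\<close> bounds the expectation of \<open>f\<close> at one
  of them. One factor \<open>n\<close> counts
  the positions of the first removed edge, and the factor \<open>n + 1\<close> is the cost of
  conditioning on exactly \<open>k\<close> removed edges. Only \<open>k - 1\<close> factors \<open>\<psi>\<close> appear, as one arc is dropped.
\<close>

lemma sum_prod_arc_gap_le:
  fixes f :: "nat \<Rightarrow> real" and n k :: nat and \<psi> :: real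
  assumes f: "\<And>l. 0 \<le> f l" "\<And>l. f l \<le> 1"
    and k: "0 < k" "2 * k \<le> n"
  defines "p \<equiv> real k / real n"
  assumes \<psi>: "(\<Sum>l=1..n. f l * (p * (1 - p) ^ (l - 1))) \<le> \<psi>"
  shows "(\<Sum>S | S \<subseteq> {..<n} \<and> card S = k. \<Prod>e\<in>S. f (arc_gap n S e))
           \<le> n * (n + 1) * \<psi> ^ (k - 1) * (n choose k)"
proof -
  define q where "q = 1 - p"
  have p: "0 < p" "p \<le> 1/2" using k by (auto simp: p_def field_simps)
  have q: "0 < q" "q \<le> 1" "p \<le> q" using p by (auto simp: q_def)
  define \<phi> where "\<phi> = \<psi> * q / p"
  let ?\<F> = "{S. S \<subseteq> {..<n} \<and> card S = k}"
  have "0 \<le> (\<Sum>l=1..n. f l * (p * q ^ (l - 1)))" using f p q by (intro sum_nonneg) auto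
  then have \<psi>0: "0 \<le> \<psi>" using \<psi> by (simp add: q_def)
  have "(\<Sum>l=1..n. f l * q ^ l) = (\<Sum>l=1..n. f l * (p * q ^ (l - 1))) * q / p"
    unfolding sum_distrib_right sum_divide_distrib
  proof (rule sum.cong[OF refl])
    fix l assume "l \<in> {1..n}"
    then have "q ^ l = q * q ^ (l - 1)" by (cases l) auto
    then show "f l * q ^ l = f l * (p * q ^ (l - 1)) * q / p" using p by simp
  qed
  also have "\<dots> \<le> \<phi>"
    unfolding \<phi>_def using \<psi> p q by (intro divide_right_mono mult_right_mono) (auto simp: q_def)
  finally have \<phi>: "(\<Sum>l=1..n. f l * q ^ l) \<le> \<phi>" .

  have "q ^ n * (\<Sum>S\<in>?\<F>. \<Prod>e\<in>S. f (arc_gap n S e))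
      \<le> (\<Sum>S\<in>?\<F>. path_weight f S * q ^ (n - Min S))"
    unfolding sum_distrib_left
  proof (rule sum_mono)
    fix S assume "S \<in> ?\<F>"
    then have S: "S \<subseteq> {..<n}" "S \<noteq> {}" using k by auto
    have "q ^ n * (\<Prod>e\<in>S. f (arc_gap n S e)) \<le> q ^ (n - Min S) * path_weight f S"
      using S f q path_weight_nonneg[of f S]
      by (intro mult_mono prod_arc_gap_le_path_weight power_decreasing prod_nonneg) auto
    then show "q ^ n * (\<Prod>e\<in>S. f (arc_gap n S e)) \<le> path_weight f S * q ^ (n - Min S)"
      by (simp add: mult.commute)
  qed
  also have "\<dots> \<le> n * \<phi> ^ (k - 1)"
    using sum_path_weight_le[OF f(1) q(1,2) \<phi>, of "k - 1"] k by simp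
  finally have le: "q ^ n * (\<Sum>S\<in>?\<F>. \<Prod>e\<in>S. f (arc_gap n S e)) \<le> n * \<phi> ^ (k - 1)" .

  have mode: "1 \<le> (n + 1) * (real (n choose k) * p ^ k * q ^ (n - k))"
    using binomial_mode_ge[of k n] k by (simp add: p_def q_def)
  have "q ^ n * (\<Sum>S\<in>?\<F>. \<Prod>e\<in>S. f (arc_gap n S e))
      \<le> n * \<phi> ^ (k - 1) * ((n + 1) * (real (n choose k) * p ^ k * q ^ (n - k)))"
    using le mult_left_mono[OF mode, of "n * \<phi> ^ (k - 1)"] \<psi>0 p q by (simp add: \<phi>_def)
  also have "\<phi> ^ (k - 1) * (p ^ k * q ^ (n - k)) = \<psi> ^ (k - 1) * (p * q ^ (n - 1))"
  proof -
    have "p ^ k = p * p ^ (k - 1)" using k by (cases k) auto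
    moreover have "q ^ (n - 1) = q ^ (k - 1) * q ^ (n - k)"
      using k by (simp flip: power_add)
    ultimately show ?thesis using p by (simp add: \<phi>_def power_mult_distrib power_divide)
  qed
  then have "n * \<phi> ^ (k - 1) * ((n + 1) * (real (n choose k) * p ^ k * q ^ (n - k)))
      = (n * (n + 1) * \<psi> ^ (k - 1) * (n choose k)) * (p * q ^ (n - 1))"
  proof -
    assume eq: "\<phi> ^ (k - 1) * (p ^ k * q ^ (n - k)) = \<psi> ^ (k - 1) * (p * q ^ (n - 1))"
    have "n * \<phi> ^ (k - 1) * ((n + 1) * (real (n choose k) * p ^ k * q ^ (n - k)))
        = n * (n + 1) * (n choose k) * (\<phi> ^ (k - 1) * (p ^ k * q ^ (n - k)))"
      by (simp only: mult_ac of_nat_mult)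
    also have "\<dots> = n * (n + 1) * (n choose k) * (\<psi> ^ (k - 1) * (p * q ^ (n - 1)))"
      by (simp only: eq)
    finally show ?thesis by (simp only: mult_ac of_nat_mult)
  qed
  \<comment> \<open>the factor \<open>p\<close> of the dropped arc is exchanged for \<open>q\<close>, using \<open>2 k \<le> n\<close>\<close>
  also have "\<dots> \<le> (n * (n + 1) * \<psi> ^ (k - 1) * (n choose k)) * (q * q ^ (n - 1))"
    using q \<psi>0 by (intro mult_left_mono mult_right_mono) auto
  also have "q * q ^ (n - 1) = q ^ n" using k by (cases n) auto
  finally show ?thesis
    using q by (simp add: mult.commute[of "q ^ n"] mult_le_cancel_right)
qed

section \<open>The cosine of a geometric random variable\<close>

text \<open>
  The Taylor polynomial of degree \<open>4\<close> gives \<open>1 - cos x \<ge> x\<^sup>2 (1/2 - \<pi>\<^sup>2/24)\<close> on \<open>[0, \<pi>]\<close>, and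
  \<open>\<pi>\<^sup>2 \<le> 21/2\<close>.
\<close>

lemma one_minus_cos_ge:
  fixes x :: real
  assumes "0 \<le> x" "x \<le> pi"
  shows "x\<^sup>2 / 16 \<le> 1 - cos x"
proof (cases "x = 0")
  case False
  then have x: "0 < x" using assms by simp
  obtain t where "cos x = (\<Sum>m<4. cos_coeff m * x ^ m) + cos (t + 1/2 * real (4::nat) * pi) / fact 4 * x ^ 4"
    using Maclaurin_cos_expansion2[OF x, of 4] by auto
  moreover have "(\<Sum>m<4. cos_coeff m * x ^ m) = 1 - x\<^sup>2 / 2"
  proof -
    have "{..<4} = {0, 1, 2, 3 :: nat}" by auto
    then show ?thesis by (simp add: cos_coeff_def)
  qed
  ultimately have "cos x = 1 - x\<^sup>2 / 2 + cos (t + 1/2 * real (4::nat) * pi) / fact 4 * x ^ 4" by simp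
  moreover have "cos (t + 1/2 * real (4::nat) * pi) / fact 4 * x ^ 4 \<le> 1 / 24 * x ^ 4"
    by (intro mult_right_mono) (auto simp: fact_numeral)
  moreover have "x ^ 4 \<le> (21/2) * x\<^sup>2"
  proof -
    have "pi\<^sup>2 \<le> (3.2::real)\<^sup>2" using pi_approx by (intro power_mono) auto
    moreover have "x\<^sup>2 \<le> pi\<^sup>2" using assms by (intro power_mono) auto
    ultimately have "x\<^sup>2 \<le> 21/2" by (simp add: power2_eq_square)
    then have "x\<^sup>2 * x\<^sup>2 \<le> (21/2) * x\<^sup>2" by (intro mult_right_mono) auto
    then show ?thesis by (simp flip: power_add)
  qed
  ultimately show ?thesis by linarith
qed auto

lemma exp_minus_le:
  fixes y :: real
  assumes "0 \<le> y" "y \<le> 2"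
  shows "exp (- y) \<le> 1 - y / 3"
proof -
  have "exp (- y) = 1 / exp y" by (simp add: exp_minus inverse_eq_divide)
  also have "\<dots> \<le> 1 / (1 + y)"
    using assms exp_ge_add_one_self[of y] by (intro divide_left_mono) auto
  also have "\<dots> \<le> 1 - y / 3"
  proof -
    have "1 \<le> (1 - y / 3) * (1 + y)"
    proof -
      have "0 \<le> y * (2 - y) / 3" using assms by simp
      then show ?thesis by (simp add: algebra_simps power2_eq_square)
    qed
    then show ?thesis using assms by (simp add: pos_divide_le_eq)
  qed
  finally show ?thesis .
qed

text \<open>
  With \<open>z = cis \<theta>\<close> and \<open>q = 1 - p\<close>, the sum is the real part of
  \<open>1 - p z / (1 - q z) = (1 - z) / (1 - q z)\<close>, whose denominator has squared modulus \<open>p\<^sup>2 + 2 q u\<close>.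
\<close>

lemma geometric_one_minus_cos_sums:
  fixes p \<theta> :: real
  assumes p: "0 < p" "p < 1"
  defines "u \<equiv> 1 - cos \<theta>"
  shows "(\<lambda>l. (1 - cos (\<theta> * Suc l)) * (p * (1 - p) ^ l)) sums
           ((2 - p) * u / (p\<^sup>2 + 2 * (1 - p) * u))"
proof -
  define q where "q = 1 - p"
  have q: "0 < q" "q < 1" "p = 1 - q" using p by (auto simp: q_def)
  define z where "z = cis \<theta>"
  have nz: "norm (of_real q * z) < 1" using q by (simp add: z_def norm_mult)
  have ne: "1 - of_real q * z \<noteq> 0" using nz by (metis norm_one less_irrefl right_minus_eq)
  have "(\<lambda>l. of_real p * z * (of_real q * z) ^ l) sums (of_real p * z * (1 / (1 - of_real q * z)))"
    by (intro sums_mult geometric_sums nz)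
  from sums_Re[OF this]
  have "(\<lambda>l. Re (of_real p * z * (of_real q * z) ^ l)) sums Re (of_real p * z / (1 - of_real q * z))"
    by (simp add: sums_Re)
  moreover have "Re (of_real p * z * (of_real q * z) ^ l) = cos (\<theta> * Suc l) * (p * q ^ l)" for l
  proof -
    have "of_real p * z * (of_real q * z) ^ l = of_real (p * q ^ l) * z ^ Suc l"
      by (simp add: power_mult_distrib)
    also have "z ^ Suc l = cis (\<theta> * Suc l)" using Complex.DeMoivre[of \<theta> "Suc l"] by (simp only: z_def mult.commute)
    finally show ?thesis by (simp del: of_real_mult of_real_power)
  qed
  ultimately have c: "(\<lambda>l. cos (\<theta> * Suc l) * (p * q ^ l)) sums Re (of_real p * z / (1 - of_real q * z))"
    by simp
  have "(\<lambda>l. p * q ^ l) sums (p * (1 / (1 - q)))"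
    using q by (intro sums_mult geometric_sums) auto
  then have "(\<lambda>l. p * q ^ l) sums 1" using p q by simp
  from sums_diff[OF this c]
  have "(\<lambda>l. (1 - cos (\<theta> * Suc l)) * (p * q ^ l)) sums (1 - Re (of_real p * z / (1 - of_real q * z)))"
    by (simp add: algebra_simps)
  moreover have "1 - Re (of_real p * z / (1 - of_real q * z)) = (2 - p) * u / (p\<^sup>2 + 2 * q * u)"
  proof -
    have cs: "(sin \<theta>)\<^sup>2 = 1 - (cos \<theta>)\<^sup>2" by (simp add: sin_squared_eq)
    define d where "d = (1 - q * cos \<theta>)\<^sup>2 + (q * sin \<theta>)\<^sup>2"
    have d: "d = p\<^sup>2 + 2 * q * u"
      unfolding d_def u_def power_mult_distrib cs by (simp add: q algebra_simps power2_eq_square)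
    have "d \<noteq> 0"
    proof -
      have "0 < p\<^sup>2" "0 \<le> 2 * q * u" using p q by (auto simp: u_def)
      then show ?thesis using d by linarith
    qed
    have "Re (of_real p * z / (1 - of_real q * z))
        = (p * cos \<theta> * (1 - q * cos \<theta>) - p * q * (sin \<theta>)\<^sup>2) / d"
      by (simp add: Re_divide z_def d_def power2_eq_square algebra_simps)
    then have "1 - Re (of_real p * z / (1 - of_real q * z))
        = (d - (p * cos \<theta> * (1 - q * cos \<theta>) - p * q * (sin \<theta>)\<^sup>2)) / d"
      using \<open>d \<noteq> 0\<close> by (simp add: field_simps)
    also have "d - (p * cos \<theta> * (1 - q * cos \<theta>) - p * q * (sin \<theta>)\<^sup>2) = (2 - p) * u"
      unfolding cs d u_def by (simp add: q algebra_simps power2_eq_square)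
    finally show ?thesis by (simp add: d)
  qed
  ultimately show ?thesis by (simp add: q_def)
qed

text \<open>
  As \<open>1 - cos\<close> takes values in \<open>[0, 2]\<close>, the exponential may be replaced by its upper bound
  \<open>1 - (1 - cos (\<theta> l)) / 3\<close>, which is nonnegative and has an explicit expectation. It
  decreases as \<open>1 - cos \<theta>\<close> grows, so that a lower bound \<open>\<eta>\<close> for \<open>\<theta>\<close> can be used in its place.
\<close>

lemma geometric_expectation_exp_le:
  fixes p \<theta> \<eta> :: real
  assumes p: "0 < p" "p < 1" and \<theta>: "\<eta> \<le> \<theta>" "\<theta> \<le> pi" and \<eta>: "0 \<le> \<eta>"
  shows "(\<Sum>l=1..n. exp (- (1 - cos (\<theta> * l))) * (p * (1 - p) ^ (l - 1)))
           \<le> 1 - \<eta>\<^sup>2 / (3 * (16 * p\<^sup>2 + 2 * \<eta>\<^sup>2))"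
proof -
  define u where "u = 1 - cos \<theta>"
  define D where "D = (2 - p) * u / (p\<^sup>2 + 2 * (1 - p) * u)"
  define v where "v = \<eta>\<^sup>2 / 16"
  have "\<eta>\<^sup>2 \<le> \<theta>\<^sup>2" using \<eta> \<theta> by (intro power_mono) auto
  then have vu: "v \<le> u" using one_minus_cos_ge[of \<theta>] \<eta> \<theta> unfolding u_def v_def by linarith
  have v: "0 \<le> v" by (simp add: v_def)
  have "(\<lambda>l. p * (1 - p) ^ l) sums (p * (1 / (1 - (1 - p))))"
    using p by (intro sums_mult geometric_sums) auto
  then have one: "(\<lambda>l. p * (1 - p) ^ l) sums 1" using p by simp
  have h: "(\<lambda>l. p * (1 - p) ^ l - (1 - cos (\<theta> * Suc l)) * (p * (1 - p) ^ l) / 3) sums (1 - D / 3)"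
    unfolding D_def u_def
    by (intro sums_diff one sums_divide geometric_one_minus_cos_sums p)
  have "(\<Sum>l=1..n. exp (- (1 - cos (\<theta> * l))) * (p * (1 - p) ^ (l - 1)))
      = (\<Sum>l<n. exp (- (1 - cos (\<theta> * Suc l))) * (p * (1 - p) ^ l))"
    by (rule sum.reindex_bij_witness[of _ Suc "\<lambda>l. l - 1"]) auto
  also have "\<dots> \<le> (\<Sum>l<n. p * (1 - p) ^ l - (1 - cos (\<theta> * Suc l)) * (p * (1 - p) ^ l) / 3)"
  proof (rule sum_mono)
    fix l
    have "exp (- (1 - cos (\<theta> * Suc l))) \<le> 1 - (1 - cos (\<theta> * Suc l)) / 3"
      using cos_ge_minus_one[of "\<theta> * Suc l"] by (intro exp_minus_le) (auto simp del: cos_ge_minus_one)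
    then have "exp (- (1 - cos (\<theta> * Suc l))) * (p * (1 - p) ^ l)
        \<le> (1 - (1 - cos (\<theta> * Suc l)) / 3) * (p * (1 - p) ^ l)"
      using p by (intro mult_right_mono) auto
    then show "exp (- (1 - cos (\<theta> * Suc l))) * (p * (1 - p) ^ l)
        \<le> p * (1 - p) ^ l - (1 - cos (\<theta> * Suc l)) * (p * (1 - p) ^ l) / 3"
      by (simp add: left_diff_distrib)
  qed
  also have "\<dots> \<le> 1 - D / 3"
  proof -
    have "0 \<le> p * (1 - p) ^ l - (1 - cos (\<theta> * Suc l)) * (p * (1 - p) ^ l) / 3" for l
    proof -
      have "(1 - cos (\<theta> * Suc l)) * (p * (1 - p) ^ l) \<le> 2 * (p * (1 - p) ^ l)"
        using p cos_ge_minus_one[of "\<theta> * Suc l"]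
        by (intro mult_right_mono) (auto simp del: cos_ge_minus_one)
      moreover have "0 \<le> p * (1 - p) ^ l" using p by simp
      ultimately show ?thesis by linarith
    qed
    then show ?thesis
      using sum_le_suminf[OF sums_summable[OF h], of "{..<n}"] sums_unique[OF h] by simp
  qed
  also have "\<eta>\<^sup>2 / (16 * p\<^sup>2 + 2 * \<eta>\<^sup>2) \<le> D"
  proof -
    have pos: "0 < p\<^sup>2 + 2 * v" "0 < p\<^sup>2 + 2 * u" using p v vu by (auto intro: add_pos_nonneg)
    have "\<eta>\<^sup>2 / (16 * p\<^sup>2 + 2 * \<eta>\<^sup>2) \<le> v / (p\<^sup>2 + 2 * v)"
    proof -
      have "v / (p\<^sup>2 + 2 * v) = (16 * v) / (16 * (p\<^sup>2 + 2 * v))"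
        by (simp only: mult_divide_mult_cancel_left_if) simp
      also have "\<dots> = \<eta>\<^sup>2 / (16 * p\<^sup>2 + 2 * \<eta>\<^sup>2)" by (simp add: v_def algebra_simps)
      finally show ?thesis by simp
    qed
    also have "v / (p\<^sup>2 + 2 * v) \<le> u / (p\<^sup>2 + 2 * u)"
    proof -
      have "v * p\<^sup>2 \<le> u * p\<^sup>2" using vu by (intro mult_right_mono) auto
      then show ?thesis using pos by (simp add: frac_le_eq divide_le_0_iff) (simp add: algebra_simps)
    qed
    also have "\<dots> \<le> D"
    proof -
      have "0 < p\<^sup>2 + 2 * (1 - p) * u" using p v vu by (auto intro: add_pos_nonneg)
      moreover have "2 * (1 - p) * u \<le> 2 * u" using p v vu by (intro mult_right_mono) auto
      moreover have "1 * u \<le> (2 - p) * u" using p v vu by (intro mult_right_mono) auto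
      ultimately show ?thesis unfolding D_def using v vu by (intro frac_le) auto
    qed
    finally show ?thesis .
  qed
  then have "1 - D / 3 \<le> 1 - \<eta>\<^sup>2 / (3 * (16 * p\<^sup>2 + 2 * \<eta>\<^sup>2))"
    using divide_right_mono[of "\<eta>\<^sup>2 / (16 * p\<^sup>2 + 2 * \<eta>\<^sup>2)" D 3]
    by (simp only: divide_divide_eq_left mult.commute) simp
  finally show ?thesis by simp
qed

section \<open>All frequencies simultaneously\<close>

text \<open>
  Chernoff bound for a fixed angle: Markov's inequality for the exponential of minus the sum.
\<close>

lemma card_small_spread_le:
  fixes n k :: nat and \<theta> \<eta> a :: real
  assumes k: "0 < k" "2 * k \<le> n" and \<theta>: "\<eta> \<le> \<theta>" "\<theta> \<le> pi" "0 \<le> \<eta>"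
  defines "p \<equiv> real k / real n"
  defines "\<kappa> \<equiv> \<eta>\<^sup>2 / (3 * (16 * p\<^sup>2 + 2 * \<eta>\<^sup>2))"
  shows "real (card {S. S \<subseteq> {..<n} \<and> card S = k \<and> (\<Sum>e\<in>S. 1 - cos (\<theta> * arc_gap n S e)) \<le> a})
          \<le> exp (a - \<kappa> * (real k - 1)) * (n * (n + 1)) * (n choose k)"
proof -
  define f where "f l = exp (- (1 - cos (\<theta> * real l)))" for l :: nat
  have f: "0 \<le> f l" "f l \<le> 1" for l by (simp_all add: f_def)
  have p: "0 < p" "p < 1" using k by (auto simp: p_def)
  have \<psi>: "(\<Sum>l=1..n. f l * (p * (1 - p) ^ (l - 1))) \<le> 1 - \<kappa>"
    unfolding f_def \<kappa>_def by (rule geometric_expectation_exp_le[OF p \<theta>])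
  have \<kappa>: "\<kappa> \<le> 1"
  proof -
    have "0 \<le> (\<Sum>l=1..n. f l * (p * (1 - p) ^ (l - 1)))"
      using f p by (intro sum_nonneg) auto
    then show ?thesis using \<psi> by linarith
  qed
  let ?\<F> = "{S. S \<subseteq> {..<n} \<and> card S = k}"
  let ?D = "\<lambda>S. \<Sum>e\<in>S. 1 - cos (\<theta> * arc_gap n S e)"
  have fin: "finite ?\<F>" by (rule finite_subset[of _ "Pow {..<n}"]) auto
  have prod_f: "(\<Prod>e\<in>S. f (arc_gap n S e)) = exp (- ?D S)" if "finite S" for S
    unfolding f_def using that by (simp only: exp_sum sum_negf[symmetric])
  have "real (card {S \<in> ?\<F>. ?D S \<le> a}) = (\<Sum>S\<in>{S \<in> ?\<F>. ?D S \<le> a}. 1)"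
    by simp
  also have "\<dots> \<le> (\<Sum>S\<in>{S \<in> ?\<F>. ?D S \<le> a}. exp a * (\<Prod>e\<in>S. f (arc_gap n S e)))"
  proof (rule sum_mono)
    fix S assume S: "S \<in> {S \<in> ?\<F>. ?D S \<le> a}"
    then have "finite S" using finite_subset[of S "{..<n}"] by auto
    then have "exp a * (\<Prod>e\<in>S. f (arc_gap n S e)) = exp (a - ?D S)"
      by (simp only: prod_f mult_exp_exp) simp
    then show "1 \<le> exp a * (\<Prod>e\<in>S. f (arc_gap n S e))" using S by simp
  qed
  also have "\<dots> \<le> (\<Sum>S\<in>?\<F>. exp a * (\<Prod>e\<in>S. f (arc_gap n S e)))"
    using fin f by (intro sum_mono2) (auto intro!: prod_nonneg mult_nonneg_nonneg)
  also have "\<dots> = exp a * (\<Sum>S\<in>?\<F>. \<Prod>e\<in>S. f (arc_gap n S e))"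
    by (simp only: sum_distrib_left)
  also have "\<dots> \<le> exp a * (n * (n + 1) * (1 - \<kappa>) ^ (k - 1) * (n choose k))"
    using sum_prod_arc_gap_le[OF f k \<psi>[unfolded p_def]] by (intro mult_left_mono) auto
  also have "\<dots> \<le> exp a * (n * (n + 1) * exp (- \<kappa> * (real k - 1)) * (n choose k))"
  proof -
    have "(1 - \<kappa>) ^ (k - 1) \<le> exp (- \<kappa>) ^ (k - 1)"
      using \<kappa> exp_ge_add_one_self[of "- \<kappa>"] by (intro power_mono) auto
    also have "\<dots> = exp (- \<kappa> * (real k - 1))"
      using k by (simp add: exp_of_nat_mult[symmetric] of_nat_diff mult.commute)
    finally show ?thesis by (intro mult_left_mono mult_right_mono) auto
  qed
  also have "\<dots> = exp (a - \<kappa> * (real k - 1)) * (n * (n + 1)) * (n choose k)"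
  proof -
    have "exp (a - \<kappa> * (real k - 1)) = exp a * exp (- \<kappa> * (real k - 1))"
      by (simp only: mult_exp_exp) simp
    then show ?thesis by (simp only: mult_ac)
  qed
  finally show ?thesis by (simp only: mem_Collect_eq conj_assoc)
qed

lemma abs_cos_diff_le:
  fixes x y :: real
  shows "\<bar>cos x - cos y\<bar> \<le> \<bar>x - y\<bar>"
proof -
  have "\<bar>cos x - cos y\<bar> = 2 * \<bar>sin ((x + y) / 2)\<bar> * \<bar>sin ((y - x) / 2)\<bar>"
    by (simp add: cos_diff_cos abs_mult)
  also have "\<dots> \<le> 2 * 1 * \<bar>(y - x) / 2\<bar>"
    by (intro mult_mono abs_sin_x_le_abs_x) auto
  finally show ?thesis by simp
qed

text \<open>
  The sum is Lipschitz in the angle with constant \<open>\<Sum> g \<le> n\<close>, so rounding \<open>\<theta>\<close> down to a multiple of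
  \<open>1 / n\<close> changes it by at most \<open>1\<close>. Multiples up to \<open>4 n\<close> suffice because \<open>\<pi> < 4\<close>.
\<close>

lemma spread_from_grid:
  fixes g :: "'a \<Rightarrow> nat" and n :: nat and a \<eta> \<theta> :: real
  assumes n: "0 < n" and sum_g: "(\<Sum>e\<in>S. g e) \<le> n"
    and grid: "\<And>j. j \<le> 4 * n \<Longrightarrow> \<eta> \<le> j / n \<Longrightarrow> j / n \<le> pi \<Longrightarrow>
                 a < (\<Sum>e\<in>S. 1 - cos (real j / real n * g e))"
    and \<theta>: "\<eta> + 1 / n \<le> \<theta>" "\<theta> \<le> pi" "0 \<le> \<eta>"
  shows "a - 1 < (\<Sum>e\<in>S. 1 - cos (\<theta> * g e))"
proof -
  define j where "j = nat \<lfloor>\<theta> * n\<rfloor>"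
  have "0 \<le> 1 / real n" by simp
  then have "0 \<le> \<theta>" using \<theta> by linarith
  then have "real j = of_int \<lfloor>\<theta> * n\<rfloor>" by (simp add: j_def)
  then have j: "real j \<le> \<theta> * n" "\<theta> * n < real j + 1" by linarith+
  then have jn: "real j / n \<le> \<theta>" "\<theta> \<le> real j / n + 1 / n"
    using n
    by (simp_all add: add_divide_distrib[symmetric] pos_divide_le_eq pos_le_divide_eq)
  have "real j \<le> 4 * real n"
  proof -
    have "\<theta> * n \<le> 4 * real n" using \<theta> pi_less_4 by (intro mult_right_mono) auto
    then show ?thesis using j by linarith
  qed
  then have "j \<le> 4 * n" by linarith
  then have "a < (\<Sum>e\<in>S. 1 - cos (real j / real n * g e))"
    by (rule grid) (use jn \<theta> in linarith)+
  also have "\<dots> \<le> (\<Sum>e\<in>S. 1 - cos (\<theta> * g e) + 1 / n * g e)"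
  proof (rule sum_mono)
    fix e
    have "\<bar>cos (\<theta> * g e) - cos (real j / real n * g e)\<bar> \<le> \<bar>\<theta> * g e - real j / real n * g e\<bar>"
      by (rule abs_cos_diff_le)
    also have "\<dots> = (\<theta> - real j / n) * g e"
      using jn(1) by (simp only: left_diff_distrib[symmetric] abs_mult abs_of_nat)
    also have "\<dots> \<le> 1 / n * g e"
      using jn by (intro mult_right_mono) auto
    finally show "1 - cos (real j / real n * g e) \<le> 1 - cos (\<theta> * g e) + 1 / n * g e" by linarith
  qed
  also have "\<dots> = (\<Sum>e\<in>S. 1 - cos (\<theta> * g e)) + 1 / n * real (\<Sum>e\<in>S. g e)"
    by (simp only: sum.distrib sum_distrib_left of_nat_sum)
  also have "\<dots> \<le> (\<Sum>e\<in>S. 1 - cos (\<theta> * g e)) + 1 / n * n"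
    using sum_g by (intro add_left_mono mult_left_mono) (simp_all del: of_nat_sum)
  finally show ?thesis using n by simp
qed

lemma card_not_spread_le:
  fixes n k :: nat and \<eta> a :: real
  assumes k: "0 < k" "2 * k \<le> n" and \<eta>: "0 \<le> \<eta>"
  defines "p \<equiv> real k / real n"
  defines "\<kappa> \<equiv> \<eta>\<^sup>2 / (3 * (16 * p\<^sup>2 + 2 * \<eta>\<^sup>2))"
  shows "real (card {S. S \<subseteq> {..<n} \<and> card S = k \<and>
             (\<exists>\<theta> :: real. \<eta> + 1 / n \<le> \<theta> \<and> \<theta> \<le> pi \<and> (\<Sum>e\<in>S. 1 - cos (\<theta> * arc_gap n S e)) \<le> a - 1)})
          \<le> (4 * n + 1) * (exp (a - \<kappa> * (real k - 1)) * (n * (n + 1)) * (n choose k))"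
proof -
  define B where "B j = {S. S \<subseteq> {..<n} \<and> card S = k \<and>
      (\<Sum>e\<in>S. 1 - cos (real j / real n * arc_gap n S e)) \<le> a}" for j :: nat
  define J where "J = {j. j \<le> 4 * n \<and> \<eta> \<le> j / n \<and> j / n \<le> pi}"
  let ?b = "exp (a - \<kappa> * (real k - 1)) * (n * (n + 1)) * (n choose k)"
  have J: "J \<subseteq> {..4 * n}" by (auto simp: J_def)
  then have fin_J: "finite J" and card_J: "card J \<le> 4 * n + 1"
    using finite_subset card_mono[OF _ J] by auto
  have "{S. S \<subseteq> {..<n} \<and> card S = k \<and>
      (\<exists>\<theta> :: real. \<eta> + 1 / n \<le> \<theta> \<and> \<theta> \<le> pi \<and> (\<Sum>e\<in>S. 1 - cos (\<theta> * arc_gap n S e)) \<le> a - 1)}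
    \<subseteq> (\<Union>j\<in>J. B j)" (is "?L \<subseteq> ?R")
  proof
    fix S assume "S \<in> ?L"
    then obtain \<theta> :: real where S: "S \<subseteq> {..<n}" "card S = k"
      and \<theta>: "\<eta> + 1 / n \<le> \<theta>" "\<theta> \<le> pi" "(\<Sum>e\<in>S. 1 - cos (\<theta> * arc_gap n S e)) \<le> a - 1"
      by auto
    show "S \<in> ?R"
    proof (rule ccontr)
      assume "S \<notin> ?R"
      then have "a < (\<Sum>e\<in>S. 1 - cos (real j / real n * arc_gap n S e))"
        if "j \<le> 4 * n" "\<eta> \<le> j / n" "j / n \<le> pi" for j
      proof -
        have "j \<in> J" using that by (simp add: J_def)
        then have "S \<notin> B j" using \<open>S \<notin> ?R\<close> by blast
        then show ?thesis using S by (simp add: B_def not_le)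
      qed
      from spread_from_grid[OF _ sum_arc_gap_le[OF S(1)] this \<theta>(1,2) \<eta>] k \<theta>(3)
      show False by force
    qed
  qed
  moreover have "finite ?R"
    by (rule finite_subset[of _ "Pow {..<n}"]) (auto simp: B_def)
  ultimately have "card ?L \<le> card ?R" by (rule card_mono[rotated])
  also have "\<dots> \<le> (\<Sum>j\<in>J. card (B j))" by (rule card_UN_le[OF fin_J])
  finally have "real (card ?L) \<le> (\<Sum>j\<in>J. real (card (B j)))"
    unfolding of_nat_sum[symmetric] of_nat_le_iff .
  also have "\<dots> \<le> (\<Sum>j\<in>J. ?b)"
    unfolding B_def \<kappa>_def p_def
    by (intro sum_mono card_small_spread_le k \<eta>) (auto simp: J_def)
  also have "\<dots> = card J * ?b" by simp
  also have "\<dots> \<le> (4 * n + 1) * ?b"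
    using card_J by (intro mult_right_mono) (auto simp flip: of_nat_le_iff)
  finally show ?thesis by simp
qed

section \<open>The mixing rate of a random graph\<close>

text \<open>
  The length bound \<open>L = (\<rho> + 1) (n / k) ln k\<close> makes the probability of a longer arc at most
  \<open>n exp (1 - (\<rho> + 1) ln k) \<le> 3 / k\<close>. Angles are split at \<open>1 / L = 2 \<eta>\<close>, which leaves room for the grid
  width \<open>1 / n \<le> \<eta>\<close>, and \<open>\<kappa>\<close> is the loss in \<open>geometric_expectation_exp_le\<close> for this \<open>\<eta>\<close>. The threshold
  \<open>a = \<kappa> k / 4\<close> leaves half of the exponent \<open>\<kappa> (k - 1) \<ge> \<kappa> k / 2\<close> of the Chernoff bound.
\<close>

lemma prob_mixing_rate_ge:
  fixes n k :: nat and \<rho> \<gamma> \<kappa> :: real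
  assumes k: "2 \<le> k" "2 * k \<le> n" and n: "real n \<le> real k powr \<rho>" and \<rho>: "1 \<le> \<rho>"
    and ln: "1 \<le> ln (real k)" "2 * (\<rho> + 1) * ln (real k) \<le> k" and \<gamma>: "0 \<le> \<gamma>"
    and max_gap: "2 * (\<rho> + 1) * ln (real k) \<le> ln (real k) powr \<gamma>"
    and \<kappa>: "\<kappa> = 1 / (3 * (64 * (\<rho> + 1)\<^sup>2 * (ln (real k))\<^sup>2 + 2))"
    and margin: "4 * k / ln (real k) powr \<gamma> + 1 \<le> \<kappa> * k / 4"
  shows "1 - (3 / k + 10 * (real k powr (3 * \<rho>)) * exp (- (\<kappa> * k / 4)))
     \<le> measure_pmf.prob (removed_edges n k)
          {S. mixing_rate (transition_matrix n (pure_drift n S)) > real k / (real n * ln (real k) powr \<gamma>)}"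
proof -
  define \<Lambda> where "\<Lambda> = ln (real k)"
  define L where "L = (\<rho> + 1) * \<Lambda> * n / k"
  define m where "m = nat \<lfloor>L\<rfloor>"
  define \<eta> where "\<eta> = 1 / (2 * L)"
  define \<delta> where "\<delta> = real k / (real n * \<Lambda> powr \<gamma>)"
  define a where "a = \<kappa> * k / 4"
  have \<Lambda>: "1 \<le> \<Lambda>" using ln by (simp add: \<Lambda>_def)
  have pos: "0 < real k" "0 < real n" using k by auto
  have L: "0 < L" using \<Lambda> \<rho> pos by (simp add: L_def)
  have Lk: "L * k = (\<rho> + 1) * \<Lambda> * n" using pos by (simp add: L_def)
  have Ln: "2 * L \<le> n"
  proof -
    have "2 * (\<rho> + 1) * \<Lambda> * n \<le> real k * n" using ln by (intro mult_right_mono) (auto simp: \<Lambda>_def)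
    then have "2 * L * k \<le> n * k" using Lk by (simp add: algebra_simps)
    then show ?thesis using pos by simp
  qed
  have m: "real m \<le> L" "L < real m + 1"
    using L by (auto simp: m_def)
  then have mn: "m \<le> n" using Ln L by linarith

  have \<kappa>': "\<eta>\<^sup>2 / (3 * (16 * (real k / real n)\<^sup>2 + 2 * \<eta>\<^sup>2)) = \<kappa>"
  proof -
    define c where "c = (\<rho> + 1) * \<Lambda>"
    have c: "0 < c" using \<Lambda> \<rho> by (simp add: c_def)
    have "L = c * n / k" by (simp add: L_def c_def)
    then have \<eta>: "real k / real n = 2 * c * \<eta>" "\<eta> \<noteq> 0" using pos c by (auto simp: \<eta>_def)
    have "3 * (16 * (real k / real n)\<^sup>2 + 2 * \<eta>\<^sup>2) = \<eta>\<^sup>2 * (3 * (64 * c\<^sup>2 + 2))"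
      unfolding \<eta>(1) by (simp add: power2_eq_square algebra_simps)
    then have "\<eta>\<^sup>2 / (3 * (16 * (real k / real n)\<^sup>2 + 2 * \<eta>\<^sup>2)) = 1 / (3 * (64 * c\<^sup>2 + 2))"
      using \<eta>(2) by simp
    then show ?thesis unfolding \<kappa> c_def \<Lambda>_def power_mult_distrib by (simp only: mult.assoc)
  qed

  let ?\<F> = "{S. S \<subseteq> {..<n} \<and> card S = k}"
  let ?G = "{S. mixing_rate (transition_matrix n (pure_drift n S)) > \<delta>}"
  define B1 where "B1 = {S. S \<subseteq> {..<n} \<and> card S = k \<and> (\<exists>e\<in>S. m < arc_gap n S e)}"
  define B2 where "B2 = {S. S \<subseteq> {..<n} \<and> card S = k \<and>
      (\<exists>\<theta>::real. \<eta> + 1 / n \<le> \<theta> \<and> \<theta> \<le> pi \<and> (\<Sum>e\<in>S. 1 - cos (\<theta> * arc_gap n S e)) \<le> a - 1)}"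
  have fin: "finite ?\<F>" by (rule finite_subset[of _ "Pow {..<n}"]) auto
  have card_\<F>: "card ?\<F> = n choose k" using n_subsets[of "{..<n}" k] by simp
  have choose: "0 < real (n choose k)" using k by simp

  have sub: "?\<F> - ?G \<subseteq> B1 \<union> B2"
  proof (rule subsetI, rule ccontr)
    fix S assume S': "S \<in> ?\<F> - ?G" and nB: "S \<notin> B1 \<union> B2"
    then have S: "S \<subseteq> {..<n}" "card S = k" by auto
    have "\<delta> < mixing_rate (transition_matrix n (pure_drift n S))"
    proof (rule mixing_rate_gt_if_spread[OF S(1), where L = L])
      show "2 \<le> card S" using S k by simp
      show "real (arc_gap n S e) \<le> L" if "e \<in> S" for e
      proof -
        have "arc_gap n S e \<le> m" using nB S that by (auto simp: B1_def not_less)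
        then show ?thesis using m by linarith
      qed
      show "0 \<le> \<delta>" by (simp add: \<delta>_def)
      have "1 \<le> \<Lambda> powr \<gamma>" using \<Lambda> \<gamma> by (simp add: ge_one_powr_ge_zero)
      then have "real n * 1 \<le> real n * \<Lambda> powr \<gamma>" by (intro mult_left_mono) auto
      moreover have "0 < \<Lambda> powr \<gamma>" using \<Lambda> by simp
      ultimately have "\<delta> \<le> real k / real n"
        unfolding \<delta>_def using pos by (intro divide_left_mono mult_pos_pos) auto
      also have "\<dots> \<le> 1 / 2" using k pos by (simp add: field_simps)
      finally show "\<delta> \<le> 1 / 2" .
      have "2 * \<delta> * L = 2 * (\<rho> + 1) * \<Lambda> / \<Lambda> powr \<gamma>"
        using pos \<Lambda> by (simp add: \<delta>_def L_def)
      also have "\<dots> \<le> 1" using max_gap \<Lambda> by (simp add: \<Lambda>_def pos_divide_le_eq)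
      finally show "2 * \<delta> * L \<le> 1" .
    next
      fix \<theta> :: real assume \<theta>: "1 / L \<le> \<theta>" "\<theta> \<le> pi"
      have "1 / n \<le> \<eta>" unfolding \<eta>_def using Ln L pos by (intro divide_left_mono) auto
      moreover have "2 * \<eta> = 1 / L" by (simp add: \<eta>_def)
      ultimately have "\<eta> + 1 / n \<le> \<theta>" using \<theta> by linarith
      then have "S \<in> B2" if "(\<Sum>e\<in>S. 1 - cos (\<theta> * arc_gap n S e)) \<le> a - 1"
        unfolding B2_def using that S \<theta> by blast
      then have "a - 1 < (\<Sum>e\<in>S. 1 - cos (\<theta> * arc_gap n S e))"
        using nB by fastforce
      moreover have "4 * \<delta> * n = 4 * k / \<Lambda> powr \<gamma>" using pos by (simp add: \<delta>_def)
      ultimately show "4 * \<delta> * n < (\<Sum>e\<in>S. 1 - cos (\<theta> * arc_gap n S e))"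
        using margin by (simp add: a_def \<Lambda>_def)
    qed
    then show False using S' by simp
  qed

  have "real (card B1) \<le> n * (1 - m / n) ^ k * real (n choose k)"
    unfolding B1_def using k mn by (intro card_large_gap_le) auto
  also have "n * (1 - m / n) ^ k \<le> 3 / k"
  proof -
    have "(1 - m / n) ^ k \<le> exp (- (m / n)) ^ k"
      using mn pos exp_ge_add_one_self[of "- (m / n)"] by (intro power_mono) auto
    also have "\<dots> = exp (- (m / n) * k)" by (simp only: exp_of_nat_mult[symmetric] mult.commute)
    also have "\<dots> \<le> exp (1 - (\<rho> + 1) * \<Lambda>)"
    proof -
      have "(L - 1) * k \<le> real m * real k" using m by (intro mult_right_mono) auto
      then have "(\<rho> + 1) * \<Lambda> * n - k \<le> real m * real k" using Lk by (simp add: algebra_simps)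
      then have "(\<rho> + 1) * \<Lambda> * n - n \<le> real m * real k" using k by linarith
      then have "((\<rho> + 1) * \<Lambda> - 1) * n \<le> real m * real k" by (simp add: algebra_simps)
      then have "(\<rho> + 1) * \<Lambda> - 1 \<le> m / n * k" using pos by (simp add: pos_le_divide_eq)
      then show ?thesis by simp
    qed
    also have "\<dots> = exp 1 * real k powr (- (\<rho> + 1))"
    proof -
      have "real k powr (- (\<rho> + 1)) = exp (- (\<rho> + 1) * \<Lambda>)"
        using pos by (simp only: powr_def \<Lambda>_def) simp
      then show ?thesis by (simp only: mult_exp_exp) (simp add: algebra_simps)
    qed
    also have "\<dots> \<le> 3 * real k powr (- (\<rho> + 1))"
      using exp_le by (intro mult_right_mono) auto
    finally have "n * (1 - m / n) ^ k \<le> real k powr \<rho> * (3 * real k powr (- (\<rho> + 1)))"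
      using n mn pos by (intro mult_mono) auto
    also have "\<dots> = 3 * real k powr (\<rho> + - (\<rho> + 1))" unfolding powr_add by simp
    also have "\<dots> = 3 / k" using pos by (simp add: powr_minus_divide)
    finally show ?thesis .
  qed
  finally have B1: "real (card B1) \<le> 3 / k * real (n choose k)"
    by (simp add: mult_right_mono)

  have "real (card B2) \<le> (4 * n + 1) * (exp (a - \<kappa> * (real k - 1)) * (n * (n + 1)) * (n choose k))"
    unfolding B2_def \<kappa>'[symmetric] using k L by (intro card_not_spread_le) (auto simp: \<eta>_def)
  also have "\<dots> \<le> 10 * real n ^ 3 * (exp (- (\<kappa> * k / 4)) * (n choose k))"
  proof -
    have n1: "1 \<le> real n" using k by simp
    have "(4 * real n + 1) * (real n * (real n + 1)) \<le> (5 * real n) * (real n * (2 * real n))"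
      using n1 by (intro mult_mono) auto
    also have "\<dots> = 10 * real n ^ 3" by (simp add: power3_eq_cube)
    finally have poly: "(4 * real n + 1) * (real n * (real n + 1)) \<le> 10 * real n ^ 3" .
    have "0 \<le> \<kappa>" unfolding \<kappa> by simp
    then have "\<kappa> * (k / 2) \<le> \<kappa> * (real k - 1)" using k by (intro mult_left_mono) auto
    then have "exp (a - \<kappa> * (real k - 1)) \<le> exp (- (\<kappa> * k / 4))" by (simp add: a_def)
    then have "(4 * real n + 1) * (real n * (real n + 1)) * (exp (a - \<kappa> * (real k - 1)) * (n choose k))
        \<le> 10 * real n ^ 3 * (exp (- (\<kappa> * k / 4)) * (n choose k))"
      by (intro mult_mono[OF poly mult_right_mono]) auto
    then show ?thesis by (simp only: of_nat_mult of_nat_add of_nat_1 of_nat_numeral mult_ac)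
  qed
  also have "\<dots> \<le> 10 * (real k powr (3 * \<rho>)) * (exp (- (\<kappa> * k / 4)) * (n choose k))"
  proof -
    have "real n ^ 3 \<le> (real k powr \<rho>) ^ 3" using n by (intro power_mono) auto
    also have "\<dots> = real k powr (3 * \<rho>)" using pos by (simp add: powr_power mult.commute)
    finally show ?thesis by (intro mult_right_mono mult_left_mono) auto
  qed
  finally have B2: "real (card B2) \<le> 10 * (real k powr (3 * \<rho>)) * exp (- (\<kappa> * k / 4)) * (n choose k)"
    by (simp only: mult.assoc)

  define \<epsilon> where "\<epsilon> = 3 / k + 10 * (real k powr (3 * \<rho>)) * exp (- (\<kappa> * k / 4))"
  have finB: "finite (B1 \<union> B2)"
    by (rule finite_subset[of _ "Pow {..<n}"]) (auto simp: B1_def B2_def)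
  have "real (card ?\<F>) = card (?\<F> \<inter> ?G) + real (card (?\<F> - ?G))"
    unfolding of_nat_add[symmetric] card_Int_Diff[OF fin, of ?G] ..
  also have "card (?\<F> - ?G) \<le> card B1 + card B2"
    using card_mono[OF finB sub] card_Un_le[of B1 B2] by linarith
  finally have "(1 - \<epsilon>) * (n choose k) \<le> card (?\<F> \<inter> ?G)"
    using B1 B2 by (simp add: card_\<F> \<epsilon>_def algebra_simps)
  then have "1 - \<epsilon> \<le> card (?\<F> \<inter> ?G) / (n choose k)"
    using choose by (simp add: pos_le_divide_eq)
  also have "\<dots> = measure_pmf.prob (removed_edges n k) ?G"
  proof -
    have "?\<F> \<noteq> {}" using card_\<F> choose by force
    then show ?thesis
      unfolding removed_edges_def using fin by (simp add: measure_pmf_of_set card_\<F>)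
  qed
  finally show ?thesis by (simp add: \<epsilon>_def \<delta>_def \<Lambda>_def)
qed

theorem theorem16:
  fixes \<rho>\<^sub>l \<rho>\<^sub>u \<gamma> :: real
  assumes "1 < \<rho>\<^sub>l" and "\<rho>\<^sub>l < \<rho>\<^sub>u" and "4 < \<gamma>"
  shows "((\<lambda>(n, k). measure_pmf.prob (removed_edges n k)
            {S. mixing_rate (transition_matrix n (pure_drift n S))
                  > real k / (real n * ln (real k) powr \<gamma>)}) \<longlongrightarrow> 1)
         (inf (at_top \<times>\<^sub>F at_top)
              (principal {(n, k). \<rho>\<^sub>l < ln (real n) / ln (real k) \<and> ln (real n) / ln (real k) < \<rho>\<^sub>u}))"
    (is "(?f \<longlongrightarrow> 1) ?F")
proof -
  define \<kappa> where "\<kappa> k = 1 / (3 * (64 * (\<rho>\<^sub>u + 1)\<^sup>2 * (ln (real k))\<^sup>2 + 2))" for k :: nat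
  define \<epsilon> where "\<epsilon> k = 3 / real k + 10 * (real k powr (3 * \<rho>\<^sub>u)) * exp (- (\<kappa> k * k / 4))" for k :: nat
  \<comment> \<open>abstracting the coefficients to positive reals leaves pure asymptotics in \<open>k\<close>\<close>
  define c where "c = 64 * (\<rho>\<^sub>u + 1)\<^sup>2"
  define d where "d = 2 * (\<rho>\<^sub>u + 1)"
  have cd: "0 < c" "0 < d" "0 < \<rho>\<^sub>u" using assms by (auto simp: c_def d_def)
  have \<kappa>: "\<kappa> = (\<lambda>k. 1 / (3 * (c * (ln (real k))\<^sup>2 + 2)))" by (rule ext) (simp only: \<kappa>_def c_def)
  have lim: "\<epsilon> \<longlonglongrightarrow> 0"
    unfolding \<epsilon>_def \<kappa> using cd by real_asymp
  have large: "eventually (\<lambda>k::nat. 2 \<le> k \<and> 1 \<le> ln (real k) \<and> d * ln (real k) \<le> k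
      \<and> d * ln (real k) \<le> ln (real k) powr \<gamma>
      \<and> 4 * k / ln (real k) powr \<gamma> + 1 \<le> \<kappa> k * k / 4
      \<and> 2 * real k \<le> real k powr \<rho>\<^sub>l) at_top"
    unfolding \<kappa> using cd assms by (intro eventually_conj; real_asymp)
  have ev_k: "eventually (\<lambda>(n, k). P k) ?F" if "eventually P at_top" for P :: "nat \<Rightarrow> bool"
  proof -
    have "eventually (\<lambda>x. P (snd x)) (at_top \<times>\<^sub>F at_top :: (nat \<times> nat) filter)"
      using that by (rule eventually_compose_filterlim) (rule filterlim_snd)
    then show ?thesis
      unfolding eventually_inf_principal by eventually_elim auto
  qed
  have "eventually (\<lambda>(n, k). \<rho>\<^sub>l < ln (real n) / ln (real k) \<and> ln (real n) / ln (real k) < \<rho>\<^sub>u) ?F"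
    unfolding eventually_inf_principal by (rule always_eventually) auto
  with ev_k[OF large] have "eventually (\<lambda>x. 1 - \<epsilon> (snd x) \<le> ?f x) ?F"
  proof eventually_elim
    case (elim x)
    obtain n k where x: "x = (n, k)" by (cases x)
    have k: "2 \<le> k" "1 \<le> ln (real k)" "d * ln (real k) \<le> k" "d * ln (real k) \<le> ln (real k) powr \<gamma>"
      "4 * k / ln (real k) powr \<gamma> + 1 \<le> \<kappa> k * k / 4" "2 * real k \<le> real k powr \<rho>\<^sub>l"
      and n: "\<rho>\<^sub>l < ln (real n) / ln (real k)" "ln (real n) / ln (real k) < \<rho>\<^sub>u"
      using elim by (auto simp: x)
    have ln_n: "\<rho>\<^sub>l * ln k < ln n" "ln n < \<rho>\<^sub>u * ln k"
      using n k(2) by (simp_all add: pos_less_divide_eq pos_divide_less_eq)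
    have "0 \<le> \<rho>\<^sub>l * ln k" using assms k(2) by simp
    then have "0 < n" using ln_n by (cases n) auto
    then have n_eq: "real n = exp (ln n)" by simp
    have powr: "real k powr \<rho> = exp (\<rho> * ln k)" for \<rho> using k(1) by (simp add: powr_def)
    have n_bounds: "real k powr \<rho>\<^sub>l \<le> exp (ln n)" "exp (ln n) \<le> real k powr \<rho>\<^sub>u"
      unfolding powr exp_le_cancel_iff using ln_n by linarith+
    have "2 * k \<le> n" using k(6) n_bounds(1) unfolding n_eq[symmetric] by linarith
    moreover have "n \<le> real k powr \<rho>\<^sub>u" using n_bounds(2) unfolding n_eq[symmetric] .
    moreover have "1 \<le> \<rho>\<^sub>u" "0 \<le> \<gamma>" using assms by auto
    ultimately have "1 - \<epsilon> k \<le> ?f (n, k)"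
      unfolding \<epsilon>_def prod.case
      by (intro prob_mixing_rate_ge k(1) k(2) k(3)[unfolded d_def] k(4)[unfolded d_def] k(5) \<kappa>_def)
    then show ?case by (simp add: x)
  qed
  moreover have "eventually (\<lambda>x. ?f x \<le> 1) ?F"
    by (rule always_eventually) auto
  moreover have "((\<lambda>x. 1 - \<epsilon> (snd x)) \<longlongrightarrow> 1) ?F"
  proof -
    have "filterlim snd at_top ?F"
      by (rule filterlim_mono[OF filterlim_snd order_refl inf_le1])
    from tendsto_diff[OF tendsto_const[of 1] filterlim_compose[OF lim this]] show ?thesis
      by simp
  qed
  ultimately show ?thesis
    by (rule tendsto_sandwich) (rule tendsto_const)
qed

end
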